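(* Let $L/K$ be a Galois extension of finite even degree $n=[L:K]$ whose Galois group $G$ contains exactly $k$ elements of order $2$, say $\tau_1,\ldots,\tau_k$. Enumerate the remaining non-identity elements of $G$ as $\sigma_1,\sigma_1^{-1},\ldots,\sigma_m,\sigma_m^{-1}$, where $1+k+2m=n$. Put $B^i=\{f_{b,\tau_i}: b\in L\}$ for $1\le i\le k$ and $A^j=\{f_{b,\sigma_j}: b\in L\}$ for $1\le j\le m$. Then there is a direct sum decomposition $$\operatorname{Alt}(L)=B^1\oplus\cdots\oplus B^k\oplus A^1\oplus\cdots\oplus A^m,$$ where $\dim_K B^i=\frac n2$ for $1\le i\le k$ and $\dim_K A^j=n$ for $1\le j\le m$. For $1\le i\le k$, all non-zero elements of $B^i$ have rank $n$. For $1\le j\le m$: if $\sigma_j$ has odd order $2r+1$, all non-zero elements of $A^j$ have rank $n-\frac{n}{2r+1}$; if $\sigma_j$ has even order $2r>2$, each non-zero element of $A^j$ has rank either $n$ or $n-\frac nr$, and elements of each of these two ranks occur in $A^j$.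
   Context: $L$ is regarded as an $n$-dimensional vector space over $K$. $\operatorname{Alt}(L)$ is the $K$-vector space of all alternating $K$-bilinear forms $L\times L\to K$ (bilinear $f$ with $f(x,x)=0$ for all $x$). $\operatorname{Tr}:L\to K$ is the trace, $\operatorname{Tr}(x)=\sum_{\tau\in G}\tau(x)$. For $b\in L$ and a non-identity $\sigma\in G$, $f_{b,\sigma}\in\operatorname{Alt}(L)$ is the form $f_{b,\sigma}(x,y)=\operatorname{Tr}\big(b(x\sigma(y)-\sigma(x)y)\big)$. The rank of an alternating form $f$ is $n-\dim_K R$, where $R=\{x\in L: f(x,y)=0 \text{ for all } y\in L\}$ is its radical. *)

theory Defs
  imports
    Complex_Main
    "HOL-Library.FuncSet"
    "HOL-Library.Function_Algebras"
    "HOL-Algebra.Multiplicative_Group"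
begin

text \<open>A field extension \<open>L/K\<close> is given by an embedding \<open>\<iota>\<close> of the field \<open>K\<close> (the type \<open>'k\<close>) into the
  field \<open>L\<close> (the type \<open>'l\<close>). The vector space notions over \<open>K\<close> (\<open>module.span\<close>,
  \<open>vector_space.dim\<close>, ...) are those of the distribution, applied to the scalar
  multiplications below.\<close>

locale field_extension =
  fixes \<iota> :: "'k::field \<Rightarrow> 'l::field"
  assumes embed_add: "\<iota> (a + b) = \<iota> a + \<iota> b"
    and embed_mult: "\<iota> (a * b) = \<iota> a * \<iota> b"
    and embed_one: "\<iota> 1 = 1"

definition ext_scale :: "('k::field \<Rightarrow> 'l::field) \<Rightarrow> 'k \<Rightarrow> 'l \<Rightarrow> 'l" where
  "ext_scale \<iota> c x = \<iota> c * x"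

definition form_scale :: "'k::field \<Rightarrow> ('l \<Rightarrow> 'l \<Rightarrow> 'k) \<Rightarrow> ('l \<Rightarrow> 'l \<Rightarrow> 'k)" where
  "form_scale c f = (\<lambda>x y. c * f x y)"

definition ext_degree :: "('k::field \<Rightarrow> 'l::field) \<Rightarrow> nat" where
  "ext_degree \<iota> = vector_space.dim (ext_scale \<iota>) UNIV"

definition galois_group :: "('k::field \<Rightarrow> 'l::field) \<Rightarrow> ('l \<Rightarrow> 'l) monoid" where
  "galois_group \<iota> =
    \<lparr>carrier = {\<sigma>. bij \<sigma> \<and> (\<forall>x y. \<sigma> (x + y) = \<sigma> x + \<sigma> y) \<and> (\<forall>x y. \<sigma> (x * y) = \<sigma> x * \<sigma> y) \<and>
                  (\<forall>c. \<sigma> (\<iota> c) = \<iota> c)},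
     monoid.mult = (\<circ>), one = id\<rparr>"

text \<open>The library has no Galois extensions. Finite Galois means: of finite degree, and the fixed
  field of the group of all \<open>K\<close>-automorphisms of \<open>L\<close> is \<open>K\<close>. The finite spanning set is required
  explicitly because \<open>vector_space.dim\<close> is \<open>0\<close> for infinite-dimensional spaces.\<close>

locale finite_galois_extension = field_extension \<iota>
  for \<iota> :: "'k::field \<Rightarrow> 'l::field" +
  assumes finite_degree: "\<exists>S. finite S \<and> module.span (ext_scale \<iota>) S = UNIV"
    and fixed_field: "{x. \<forall>\<sigma>\<in>carrier (galois_group \<iota>). \<sigma> x = x} = range \<iota>"

text \<open>The trace takes values in \<open>K\<close> itself, hence the description (see \<open>embed_gal_trace\<close>).\<close>

definition gal_trace :: "('k::field \<Rightarrow> 'l::field) \<Rightarrow> 'l \<Rightarrow> 'k" where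
  "gal_trace \<iota> x = (THE c. \<iota> c = (\<Sum>\<tau>\<in>carrier (galois_group \<iota>). \<tau> x))"

definition Alt :: "('k::field \<Rightarrow> 'l::field) \<Rightarrow> ('l \<Rightarrow> 'l \<Rightarrow> 'k) set" where
  "Alt \<iota> = {f. (\<forall>y. Vector_Spaces.linear (ext_scale \<iota>) (*) (\<lambda>x. f x y)) \<and>
               (\<forall>x. Vector_Spaces.linear (ext_scale \<iota>) (*) (\<lambda>y. f x y)) \<and>
               (\<forall>x. f x x = 0)}"

definition galois_form :: "('k::field \<Rightarrow> 'l::field) \<Rightarrow> 'l \<Rightarrow> ('l \<Rightarrow> 'l) \<Rightarrow> 'l \<Rightarrow> 'l \<Rightarrow> 'k" where
  "galois_form \<iota> b \<sigma> = (\<lambda>x y. gal_trace \<iota> (b * (x * \<sigma> y - \<sigma> x * y)))"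

definition form_radical :: "('l \<Rightarrow> 'l \<Rightarrow> 'k::field) \<Rightarrow> 'l set" where
  "form_radical f = {x. \<forall>y. f x y = 0}"

definition form_rank :: "('k::field \<Rightarrow> 'l::field) \<Rightarrow> ('l \<Rightarrow> 'l \<Rightarrow> 'k) \<Rightarrow> nat" where
  "form_rank \<iota> f = ext_degree \<iota> - vector_space.dim (ext_scale \<iota>) (form_radical f)"

text \<open>Internal direct sum of a finite family of subspaces: every element of \<open>W\<close> is a sum
  \<open>\<Sum>i\<in>I. v i\<close> with \<open>v i \<in> V i\<close> in exactly one way, and all such sums lie in \<open>W\<close>.\<close>

definition internal_direct_sum ::
  "('k::field \<Rightarrow> 'v::ab_group_add \<Rightarrow> 'v) \<Rightarrow> 'v set \<Rightarrow> 'i set \<Rightarrow> ('i \<Rightarrow> 'v set) \<Rightarrow> bool" where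
  "internal_direct_sum scale W I V \<longleftrightarrow>
     finite I \<and> module.subspace scale W \<and> (\<forall>i\<in>I. module.subspace scale (V i)) \<and>
     bij_betw (\<lambda>v. \<Sum>i\<in>I. v i) (\<Pi>\<^sub>E i\<in>I. V i) W"

lemma (in field_extension) vector_space_ext_scale: "vector_space (ext_scale \<iota>)"
  by unfold_locales (auto simp: ext_scale_def embed_add embed_mult embed_one algebra_simps)

lemma vector_space_form_scale: "vector_space form_scale"
  by unfold_locales (auto simp: form_scale_def fun_eq_iff algebra_simps)

lemma group_galois_group: "group (galois_group \<iota>)"
proof (rule groupI)
  fix \<sigma> assume s: "\<sigma> \<in> carrier (galois_group \<iota>)"
  then have b: "bij \<sigma>" and a: "\<And>x y. \<sigma> (x + y) = \<sigma> x + \<sigma> y"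
    and m: "\<And>x y. \<sigma> (x * y) = \<sigma> x * \<sigma> y" and c: "\<And>c. \<sigma> (\<iota> c) = \<iota> c"
    by (auto simp: galois_group_def)
  let ?t = "the_inv \<sigma>"
  have ts: "?t (\<sigma> x) = x" and st: "\<sigma> (?t x) = x" for x
    using b by (auto simp: bij_def the_inv_f_f f_the_inv_into_f)
  have "?t \<in> carrier (galois_group \<iota>)"
    unfolding galois_group_def
    using bij_betw_the_inv_into[OF b]
    by (simp) (metis a m c ts st)
  moreover have "?t \<circ> \<sigma> = id" using ts by auto
  ultimately show "\<exists>\<tau>\<in>carrier (galois_group \<iota>). \<tau> \<otimes>\<^bsub>galois_group \<iota>\<^esub> \<sigma> = \<one>\<^bsub>galois_group \<iota>\<^esub>"
    by (auto simp: galois_group_def)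
qed (auto simp: galois_group_def bij_comp comp_assoc)

lemma (in finite_galois_extension) embed_gal_trace:
  "\<iota> (gal_trace \<iota> x) = (\<Sum>\<tau>\<in>carrier (galois_group \<iota>). \<tau> x)"
proof -
  let ?G = "carrier (galois_group \<iota>)"
  interpret G: group "galois_group \<iota>" by (rule group_galois_group)
  have mult: "\<sigma> \<otimes>\<^bsub>galois_group \<iota>\<^esub> \<tau> = \<sigma> \<circ> \<tau>" for \<sigma> \<tau> by (simp add: galois_group_def)
  have "\<sigma> (\<Sum>\<tau>\<in>?G. \<tau> x) = (\<Sum>\<tau>\<in>?G. \<tau> x)" if s: "\<sigma> \<in> ?G" for \<sigma>
  proof -
    have add: "\<sigma> (a + b) = \<sigma> a + \<sigma> b" for a b using s by (simp add: galois_group_def)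
    have zero: "\<sigma> 0 = 0" by (metis add add_0_right add_left_cancel)
    have "\<sigma> (\<Sum>\<tau>\<in>?G. \<tau> x) = (\<Sum>\<tau>\<in>?G. \<sigma> (\<tau> x))"
      using sum_comp_morphism[of \<sigma>, OF zero add, of "\<lambda>\<tau>. \<tau> x" ?G] by (simp add: o_def)
    also have "\<dots> = (\<Sum>\<tau>\<in>?G. \<tau> x)"
    proof (rule sum.reindex_bij_betw[of "\<lambda>\<tau>. \<sigma> \<circ> \<tau>" ?G ?G "\<lambda>\<tau>. \<tau> x", simplified o_apply])
      show "bij_betw (\<lambda>\<tau>. \<sigma> \<circ> \<tau>) ?G ?G"
        unfolding bij_betw_def using G.inj_on_cmult[OF s] G.surj_const_mult[OF s]
        by (simp add: mult)
    qed
    finally show ?thesis .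
  qed
  then have "(\<Sum>\<tau>\<in>?G. \<tau> x) \<in> range \<iota>"
    using fixed_field by blast
  then obtain c where c: "\<iota> c = (\<Sum>\<tau>\<in>?G. \<tau> x)" by auto
  have "d = e" if "\<iota> d = \<iota> e" for d e
  proof (rule ccontr)
    assume "d \<noteq> e"
    then have "\<iota> ((d - e) * inverse (d - e)) = 1" using embed_one by simp
    then have "\<iota> (d - e) \<noteq> 0" by (metis embed_mult mult_zero_left zero_neq_one)
    moreover have "\<iota> (d - e) + \<iota> e = \<iota> d" by (metis embed_add diff_add_cancel)
    ultimately show False using that by simp
  qed
  then have "gal_trace \<iota> x = c" unfolding gal_trace_def c[symmetric] by (intro the_equality) auto
  with c show ?thesis by simp
qed

end

theory Submission
  imports Defs "HOL-Computational_Algebra.Polynomial"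
begin

text \<open>For \<open>g \<in> G\<close> there are finitely many \<open>c\<^sub>i, e\<^sub>i \<in> L\<close> with \<open>\<Sum>\<^sub>i c\<^sub>i \<cdot> g e\<^sub>i\<close> equal to \<open>1\<close> for \<open>g = 1\<close> and to \<open>0\<close>
  otherwise. They yield Dedekind's independence of automorphisms, \<open>dim\<^sub>K Fix g = n / ord g\<close>, and the expansion of
  every bilinear form as \<open>\<Sum>\<^sub>g Tr (a\<^sub>g \<cdot> x \<cdot> g y)\<close> with uniquely determined \<open>a\<^sub>g\<close>. The form is alternating iff
  \<open>a\<^sub>1 = 0\<close> and the terms for \<open>g\<close> and \<open>g\<inverse>\<close> combine to a form \<open>f\<^sub>b\<^sub>,\<^sub>g\<close>; this is the direct sum decomposition.

  The radical of \<open>f\<^sub>b\<^sub>,\<^sub>g\<close> is \<open>{x. b x = g b \<cdot> g\<^sup>2 x}\<close>, which is \<open>0\<close> or a multiple \<open>x\<^sub>0 \<cdot> Fix (g\<^sup>2)\<close>. If \<open>g\<close> has odd order,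
  \<open>g b / b\<close> is always of the form \<open>g\<^sup>2 d / d\<close>, so the second case holds. If \<open>g\<close> has even order, \<open>b = 1\<close> has a
  non-zero radical, and a \<open>b\<close> with zero radical is found by counting when \<open>K\<close> is finite and by a norm argument
  when \<open>K\<close> is infinite.\<close>

section \<open>Finite-dimensional linear algebra\<close>

text \<open>Gaussian elimination, by induction on the equations: if equation \<open>r\<close>
  involves the unknown \<open>p\<close>, it is solved for \<open>a p\<close>, and substituting into
  the others leaves one equation and one unknown less.\<close>

lemma homogeneous_system_nontrivial:
  fixes w :: "'i \<Rightarrow> 'r \<Rightarrow> 'a::field"
  assumes "finite R" "finite I" "card R < card I"
  shows "\<exists>a. (\<exists>i\<in>I. a i \<noteq> 0) \<and> (\<forall>r\<in>R. (\<Sum>i\<in>I. a i * w i r) = 0)"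
  using assms
proof (induction R arbitrary: I w rule: finite_induct)
  case empty
  then have "I \<noteq> {}" by auto
  then show ?case by (intro exI[of _ "\<lambda>_. 1"]) auto
next
  case (insert r R)
  show ?case
  proof (cases "\<forall>i\<in>I. w i r = 0")
    case True
    have "card R < card I" using insert.prems insert.hyps by simp
    then obtain a where "\<exists>i\<in>I. a i \<noteq> 0" "\<forall>r\<in>R. (\<Sum>i\<in>I. a i * w i r) = 0"
      using insert.IH insert.prems(1) by blast
    with True show ?thesis by (intro exI[of _ a]) auto
  next
    case False
    then obtain p where p: "p \<in> I" "w p r \<noteq> 0" by auto
    define J where "J = I - {p}"
    have I: "I = insert p J" "p \<notin> J" "finite J"
      using p insert.prems(1) by (auto simp: J_def)
    have "card R < card J"
      using insert.prems insert.hyps I by simp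
    then obtain a where a: "\<exists>i\<in>J. a i \<noteq> 0"
        "\<forall>s\<in>R. (\<Sum>i\<in>J. a i * (w i s - w i r / w p r * w p s)) = 0"
      using insert.IH[of J "\<lambda>i s. w i s - w i r / w p r * w p s"] I(3) by blast
    define b where "b = a(p := - (\<Sum>i\<in>J. a i * w i r) / w p r)"
    have b: "(\<Sum>i\<in>J. b i * w i s) = (\<Sum>i\<in>J. a i * w i s)" for s
      using I(2) by (intro sum.cong) (auto simp: b_def)
    have "(\<Sum>i\<in>I. b i * w i r) = 0"
      using I p b by (simp add: b_def)
    moreover have "(\<Sum>i\<in>I. b i * w i s) = 0" if "s \<in> R" for s
    proof -
      have "(\<Sum>i\<in>I. b i * w i s) = (\<Sum>i\<in>J. a i * w i s) - (\<Sum>i\<in>J. a i * w i r) / w p r * w p s"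
        using I b by (simp add: b_def)
      also have "\<dots> = (\<Sum>i\<in>J. a i * (w i s - w i r / w p r * w p s))"
        by (simp add: algebra_simps sum_subtractf sum_distrib_left sum_distrib_right sum_divide_distrib)
      finally show ?thesis using a(2) that by simp
    qed
    moreover have "\<exists>i\<in>I. b i \<noteq> 0"
      using a(1) I by (auto simp: b_def)
    ultimately show ?thesis by (intro exI[of _ b]) auto
  qed
qed

lemma card_le_if_independent:
  fixes w :: "'i \<Rightarrow> 'r \<Rightarrow> 'a::field"
  assumes "finite R" "finite I"
    and "\<And>a. \<forall>r\<in>R. (\<Sum>i\<in>I. a i * w i r) = 0 \<Longrightarrow> \<forall>i\<in>I. a i = 0"
  shows "card I \<le> card R"
proof (rule ccontr)
  assume "\<not> card I \<le> card R"
  then obtain a where "\<exists>i\<in>I. a i \<noteq> 0" "\<forall>r\<in>R. (\<Sum>i\<in>I. a i * w i r) = 0"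
    using homogeneous_system_nontrivial[OF assms(1,2), of w] by auto
  with assms(3) show False by blast
qed

text \<open>Solutions for the unit vectors form a matrix \<open>A\<close> whose product with
  \<open>w\<close> is the identity, so the rows of \<open>A\<close> are independent. The previous
  bound applies to \<open>A\<close>, with unknowns indexed by \<open>R\<close> and equations by
  \<open>I\<close>.\<close>

lemma card_le_if_spanning:
  fixes w :: "'i \<Rightarrow> 'r \<Rightarrow> 'a::field"
  assumes fin: "finite R" "finite I"
    and span: "\<And>F. \<exists>a. \<forall>r\<in>R. F r = (\<Sum>i\<in>I. a i * w i r)"
  shows "card R \<le> card I"
proof -
  have "\<exists>a. \<forall>r\<in>R. (if r = q then 1 else 0) = (\<Sum>i\<in>I. a i * w i r)" for q
    by (rule span)
  then obtain A where A: "\<And>q r. r \<in> R \<Longrightarrow> (if r = q then 1 else 0) = (\<Sum>i\<in>I. A q i * w i r)"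
    by metis
  show ?thesis
  proof (rule card_le_if_independent[OF fin(2,1), of A], rule ballI)
    fix a r assume a: "\<forall>i\<in>I. (\<Sum>q\<in>R. a q * A q i) = 0" and r: "r \<in> R"
    have "a r = (\<Sum>q\<in>R. a q * (if r = q then 1 else 0))"
      using fin r by (simp add: sum.delta if_distrib cong: if_cong)
    also have "\<dots> = (\<Sum>q\<in>R. a q * (\<Sum>i\<in>I. A q i * w i r))"
      using A[OF r] by simp
    also have "\<dots> = (\<Sum>q\<in>R. \<Sum>i\<in>I. a q * A q i * w i r)"
      by (simp add: sum_distrib_left mult.assoc)
    also have "\<dots> = (\<Sum>i\<in>I. (\<Sum>q\<in>R. a q * A q i) * w i r)"
      by (subst sum.swap) (simp add: sum_distrib_right)
    also have "\<dots> = 0" using a by simp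
    finally show "a r = 0" .
  qed
qed

text \<open>An injective linear map takes a basis of \<open>V\<close> to a basis of the image.
  Linearity is asked for on \<open>V\<close> only, so that maps defined by a formula on a fixed
  space can be used directly.\<close>

lemma dim_linear_image:
  assumes V1: "vector_space s1" and V2: "vector_space s2"
    and sub: "module.subspace s1 V"
    and add: "\<And>x y. x \<in> V \<Longrightarrow> y \<in> V \<Longrightarrow> f (x + y) = f x + f y"
    and sc: "\<And>c x. x \<in> V \<Longrightarrow> f (s1 c x) = s2 c (f x)"
    and inj: "inj_on f V"
  shows "vector_space.dim s2 (f ` V) = vector_space.dim s1 V"
proof -
  interpret V1: vector_space s1 by fact
  interpret V2: vector_space s2 by fact
  obtain B where B: "B \<subseteq> V" "V1.independent B" "V \<subseteq> V1.span B" "card B = V1.dim V"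
    using V1.basis_exists by blast
  have 0: "0 \<in> V" using sub by (rule V1.subspace_0)
  have f0: "f 0 = 0" using add[OF 0 0] by simp
  have lin: "f (\<Sum>v\<in>t. s1 (r v) v) = (\<Sum>v\<in>t. s2 (r v) (f v))" if "finite t" "t \<subseteq> V" for t r
    using that
  proof (induction t rule: finite_induct)
    case (insert x t)
    have "(\<Sum>v\<in>t. s1 (r v) v) \<in> V" "s1 (r x) x \<in> V"
      using insert.prems sub by (auto intro!: V1.subspace_sum V1.subspace_scale)
    then show ?case using insert add sc by simp
  qed (simp add: f0)
  have fB: "inj_on f B" using inj B(1) by (rule inj_on_subset)
  have "f ` V \<subseteq> V2.span (f ` B)"
  proof
    fix y assume "y \<in> f ` V"
    then obtain x where x: "x \<in> V" "y = f x" by auto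
    then obtain t r where t: "finite t" "t \<subseteq> B" "x = (\<Sum>v\<in>t. s1 (r v) v)"
      using B(3) by (auto simp: V1.span_explicit)
    have "t \<subseteq> V" using t(2) B(1) by blast
    then have "y = (\<Sum>v\<in>t. s2 (r v) (f v))" using x t(3) lin[OF t(1)] by simp
    also have "\<dots> \<in> V2.span (f ` B)"
      using t(2) by (intro V2.span_sum V2.span_scale V2.span_base) auto
    finally show "y \<in> V2.span (f ` B)" .
  qed
  moreover have "V2.independent (f ` B)"
    unfolding V2.independent_explicit_finite_subsets
  proof (intro allI impI ballI)
    fix S u y assume S: "S \<subseteq> f ` B" "finite S" and u: "(\<Sum>v\<in>S. s2 (u v) v) = 0" and y: "y \<in> S"
    obtain t where t: "t \<subseteq> B" "S = f ` t" using S(1) by (auto simp: subset_image_iff)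
    have ft: "inj_on f t" using fB t(1) by (rule inj_on_subset)
    have fin: "finite t" using ft S(2) t(2) finite_image_iff by blast
    have tV: "t \<subseteq> V" using t(1) B(1) by blast
    have mem: "(\<Sum>v\<in>t. s1 (u (f v)) v) \<in> V"
      using tV sub by (auto intro!: V1.subspace_sum V1.subspace_scale)
    have "f (\<Sum>v\<in>t. s1 (u (f v)) v) = f 0"
      using u lin[OF fin tV] by (simp add: t(2) sum.reindex[OF ft] f0)
    then have "(\<Sum>v\<in>t. s1 (u (f v)) v) = 0"
      using inj_onD[OF inj _ mem 0] by simp
    moreover obtain v where v: "v \<in> t" "y = f v" using y t(2) by auto
    ultimately show "u y = 0"
      using V1.independentD[OF B(2) fin t(1), of "\<lambda>v. u (f v)" v] by simp
  qed
  moreover have "f ` B \<subseteq> f ` V" using B(1) by (rule image_mono)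
  ultimately have "card (f ` B) = V2.dim (f ` V)" by (intro V2.basis_card_eq_dim)
  then show ?thesis by (simp add: card_image[OF fB] B(4))
qed

section \<open>Galois groups\<close>

sublocale field_extension \<subseteq> ext: vector_space "ext_scale \<iota>"
  by (rule vector_space_ext_scale)

sublocale field_extension \<subseteq> gal: group "galois_group \<iota>"
  by (rule group_galois_group)

context field_extension
begin

abbreviation Gal :: "('l \<Rightarrow> 'l) set" where
  "Gal \<equiv> carrier (galois_group \<iota>)"

lemma embed_zero: "\<iota> 0 = 0"
  using embed_add[of 0 0] by (simp only: add_0_left add_cancel_right_right)

lemma embed_diff: "\<iota> (a - b) = \<iota> a - \<iota> b"
  using embed_add[of "a - b" b] by (simp add: algebra_simps)

lemma embed_sum: "\<iota> (sum f S) = (\<Sum>s\<in>S. \<iota> (f s))"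
  using sum_comp_morphism[of \<iota>, OF embed_zero embed_add, of f S] by (simp add: o_def)

lemma embed_eq_zero_iff: "\<iota> a = 0 \<longleftrightarrow> a = 0"
proof
  assume "\<iota> a = 0"
  then have "\<iota> (a * inverse a) = 0" by (simp only: embed_mult mult_zero_left)
  then show "a = 0" using embed_one by (cases "a = 0") auto
qed (simp add: embed_zero)

lemma embed_inject: "\<iota> a = \<iota> b \<longleftrightarrow> a = b"
  using embed_eq_zero_iff[of "a - b"] by (simp add: embed_diff)

lemma gal_mult_eq: "g \<otimes>\<^bsub>galois_group \<iota>\<^esub> h = g \<circ> h"
  by (simp add: galois_group_def)

lemma gal_one_eq: "\<one>\<^bsub>galois_group \<iota>\<^esub> = id"
  by (simp add: galois_group_def)

lemma gal_id: "id \<in> Gal"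
  using gal.one_closed by (simp add: gal_one_eq)

lemma gal_comp: "g \<in> Gal \<Longrightarrow> h \<in> Gal \<Longrightarrow> g \<circ> h \<in> Gal"
  using gal.m_closed[of g h] by (simp add: gal_mult_eq)

lemma gal_add: "g \<in> Gal \<Longrightarrow> g (x + y) = g x + g y"
  and gal_times: "g \<in> Gal \<Longrightarrow> g (x * y) = g x * g y"
  and gal_embed: "g \<in> Gal \<Longrightarrow> g (\<iota> c) = \<iota> c"
  and gal_bij: "g \<in> Gal \<Longrightarrow> bij g"
  by (simp_all add: galois_group_def)

lemma gal_zero: "g \<in> Gal \<Longrightarrow> g 0 = 0"
  using gal_embed[of g 0] by (simp add: embed_zero)

lemma gal_unit: "g \<in> Gal \<Longrightarrow> g 1 = 1"
  using gal_embed[of g 1] by (simp add: embed_one)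

lemma gal_diff: "g \<in> Gal \<Longrightarrow> g (x - y) = g x - g y"
  using gal_add[of g "x - y" y] by (simp add: algebra_simps)

lemma gal_eq_zero_iff: "g \<in> Gal \<Longrightarrow> g x = 0 \<longleftrightarrow> x = 0"
  using gal_bij[of g] gal_zero[of g] by (metis bij_is_inj inj_eq)

lemma gal_divide:
  assumes "g \<in> Gal"
  shows "g (x / y) = g x / g y"
proof (cases "y = 0")
  case False
  then have "g (x / y) * g y = g x"
    using gal_times[OF assms, of "x / y" y] by simp
  then show ?thesis
    using False by (simp add: gal_eq_zero_iff[OF assms] nonzero_eq_divide_eq)
qed (simp add: gal_zero[OF assms])

lemma gal_sum: "g \<in> Gal \<Longrightarrow> g (sum f S) = (\<Sum>s\<in>S. g (f s))"
  using sum_comp_morphism[of g f S] gal_zero[of g] gal_add[of g] by (simp add: o_def)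

lemma gal_inv_left: "g \<in> Gal \<Longrightarrow> (inv\<^bsub>galois_group \<iota>\<^esub> g) (g x) = x"
  using fun_cong[OF gal.l_inv[of g], of x] by (simp add: gal_mult_eq gal_one_eq)

lemma gal_inv_right: "g \<in> Gal \<Longrightarrow> g ((inv\<^bsub>galois_group \<iota>\<^esub> g) x) = x"
  using fun_cong[OF gal.r_inv[of g], of x] by (simp add: gal_mult_eq gal_one_eq)

text \<open>The elements \<open>\<Sum> c \<otimes> e\<close> of \<open>L \<otimes>\<^sub>K L\<close> that single out \<open>h\<close> are products of factors
  \<open>(1 \<otimes> x - s x \<otimes> 1) / (h x - s x)\<close>, one for each \<open>s \<in> S\<close>.\<close>

lemma separating_tensor:
  assumes "finite S" "S \<subseteq> Gal" "h \<in> Gal" "h \<notin> S"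
  shows "\<exists>xs. sum_list (map (\<lambda>(c, e). c * h e) xs) = 1 \<and>
              (\<forall>g\<in>S. sum_list (map (\<lambda>(c, e). c * g e) xs) = 0)"
  using assms
proof (induction S rule: finite_induct)
  case empty
  then show ?case by (intro exI[of _ "[(1, 1)]"]) (simp add: gal_unit)
next
  case (insert s S)
  then obtain xs where xs: "sum_list (map (\<lambda>(c, e). c * h e) xs) = 1"
      "\<forall>g\<in>S. sum_list (map (\<lambda>(c, e). c * g e) xs) = 0"
    by auto
  have "h \<noteq> s" using insert.prems by auto
  then obtain x where x: "h x \<noteq> s x" by auto
  define d where "d = h x - s x"
  define ys where "ys = map (\<lambda>(c, e). (c / d, x * e)) xs @ map (\<lambda>(c, e). (- c * s x / d, e)) xs"
  have ys: "sum_list (map (\<lambda>(c, e). c * g e) ys) =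
      (g x - s x) / d * sum_list (map (\<lambda>(c, e). c * g e) xs)" if "g \<in> Gal" for g
    unfolding ys_def
    by (induction xs) (auto simp: gal_times[OF that] diff_divide_distrib algebra_simps)
  have "sum_list (map (\<lambda>(c, e). c * h e) ys) = 1"
    using ys[of h] insert.prems xs(1) x by (simp add: d_def)
  moreover have "sum_list (map (\<lambda>(c, e). c * g e) ys) = 0" if "g \<in> insert s S" for g
    using ys[of g] that insert.prems xs(2) by auto
  ultimately show ?case by blast
qed

text \<open>The list of pairs becomes two indexed families, so that the sum over \<open>i<N\<close>
  can be interchanged with sums over the group.\<close>

lemma separating_family:
  assumes "finite S" "S \<subseteq> Gal" "h \<in> S"
  shows "\<exists>c e. \<exists>N::nat. \<forall>g\<in>S. (\<Sum>i<N. c i * g (e i)) = (if g = h then 1 else 0)"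
proof -
  obtain xs where xs: "sum_list (map (\<lambda>(c, e). c * h e) xs) = 1"
      "\<forall>g\<in>S - {h}. sum_list (map (\<lambda>(c, e). c * g e) xs) = 0"
    using separating_tensor[of "S - {h}" h] assms by auto
  have "(\<Sum>i<length xs. fst (xs ! i) * g (snd (xs ! i))) = sum_list (map (\<lambda>(c, e). c * g e) xs)" for g
    by (simp add: sum_list_sum_nth case_prod_unfold atLeast0LessThan)
  with xs show ?thesis
    by (intro exI[of _ "\<lambda>i. fst (xs ! i)"] exI[of _ "\<lambda>i. snd (xs ! i)"] exI[of _ "length xs"]) auto
qed

text \<open>Adding the relations at the points \<open>e i\<close> with the weights
  \<open>c i\<close> of a family separating \<open>h\<close> isolates the coefficient
  \<open>a h\<close>.\<close>

lemma dedekind_independence: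
  assumes "finite S" "S \<subseteq> Gal" "\<And>x. (\<Sum>g\<in>S. a g * g x) = 0" "h \<in> S"
  shows "a h = 0"
proof -
  obtain c e and N :: nat where
    ce: "\<forall>g\<in>S. (\<Sum>i<N. c i * g (e i)) = (if g = h then 1 else 0)"
    using separating_family[OF assms(1,2,4)] by blast
  have "a h = (\<Sum>g\<in>S. a g * (\<Sum>i<N. c i * g (e i)))"
    using assms(1,4) by (simp add: ce if_distrib cong: if_cong)
  also have "\<dots> = (\<Sum>g\<in>S. \<Sum>i<N. c i * (a g * g (e i)))"
    by (simp add: sum_distrib_left mult.left_commute)
  also have "\<dots> = (\<Sum>i<N. \<Sum>g\<in>S. c i * (a g * g (e i)))"
    by (rule sum.swap)
  also have "\<dots> = (\<Sum>i<N. c i * (\<Sum>g\<in>S. a g * g (e i)))"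
    by (simp add: sum_distrib_left)
  finally show ?thesis by (simp add: assms(3))
qed

end

context finite_galois_extension
begin

section \<open>Finiteness of the Galois group, the trace, and dimensions of fixed spaces\<close>

abbreviation tr :: "'l \<Rightarrow> 'k" where
  "tr \<equiv> gal_trace \<iota>"

lemma finite_basis:
  "\<exists>U. finite U \<and> U \<subseteq> V \<and> ext.independent U \<and> V \<subseteq> ext.span U \<and> card U = ext.dim V"
proof -
  obtain U where U: "U \<subseteq> V" "ext.independent U" "V \<subseteq> ext.span U" "card U = ext.dim V"
    using ext.basis_exists by blast
  obtain S where "finite S" "ext.span S = UNIV"
    using finite_degree by blast
  then have "finite U"
    using ext.independent_span_bound[of S U] U(2) by simp
  with U show ?thesis by blast
qed

text \<open>Automorphisms are \<open>K\<close>-linear, so a relation between them with coefficients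
  in \<open>L\<close> that holds on a finite spanning set \<open>B\<close> holds everywhere and is
  trivial by Dedekind. Hence there are at most \<open>card B\<close> of them.\<close>

lemma finite_gal: "finite Gal"
proof (rule ccontr)
  assume inf: "infinite Gal"
  obtain B where B: "finite B" "(UNIV :: 'l set) \<subseteq> ext.span B"
    using finite_basis by blast
  obtain S where S: "S \<subseteq> Gal" "finite S" "card S = Suc (card B)"
    using infinite_arbitrarily_large[OF inf] by blast
  have "card S \<le> card B"
  proof (rule card_le_if_independent[where w = "\<lambda>g x. g x"], rule B(1), rule S(2), rule ballI)
    fix a g assume a: "\<forall>r\<in>B. (\<Sum>g\<in>S. a g * g r) = 0" and g: "g \<in> S"
    have "(\<Sum>g\<in>S. a g * g x) = 0" for x
    proof -
      obtain k where x: "x = (\<Sum>b\<in>B. ext_scale \<iota> (k b) b)"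
        using B by (auto simp: ext.span_finite)
      have "(\<Sum>g\<in>S. a g * g x) = (\<Sum>g\<in>S. \<Sum>b\<in>B. \<iota> (k b) * (a g * g b))"
      proof (rule sum.cong)
        fix g assume "g \<in> S"
        then have g: "g \<in> Gal" using S(1) by blast
        have "g x = (\<Sum>b\<in>B. \<iota> (k b) * g b)"
          by (simp add: x gal_sum[OF g] ext_scale_def gal_times[OF g] gal_embed[OF g])
        then show "a g * g x = (\<Sum>b\<in>B. \<iota> (k b) * (a g * g b))"
          by (simp add: sum_distrib_left mult.left_commute)
      qed simp
      also have "\<dots> = (\<Sum>b\<in>B. \<Sum>g\<in>S. \<iota> (k b) * (a g * g b))"
        by (rule sum.swap)
      also have "\<dots> = (\<Sum>b\<in>B. \<iota> (k b) * (\<Sum>g\<in>S. a g * g b))"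
        by (simp add: sum_distrib_left)
      finally show ?thesis using a by simp
    qed
    then show "a g = 0"
      using dedekind_independence[OF S(2,1) _ g] by blast
  qed
  with S(3) show False by simp
qed

lemma separating_basis:
  "\<exists>c e. \<exists>N::nat. \<forall>g\<in>Gal. (\<Sum>i<N. c i * g (e i)) = (if g = id then 1 else 0)"
  using separating_family[OF finite_gal order_refl gal_id] .

lemma trace_add: "tr (x + y) = tr x + tr y"
proof -
  have "\<iota> (tr (x + y)) = \<iota> (tr x + tr y)"
    by (simp add: embed_add embed_gal_trace gal_add sum.distrib)
  then show ?thesis by (simp only: embed_inject)
qed

lemma trace_scale: "tr (\<iota> c * x) = c * tr x"
proof -
  have "\<iota> (tr (\<iota> c * x)) = \<iota> (c * tr x)"
    by (simp add: embed_mult embed_gal_trace gal_times gal_embed sum_distrib_left)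
  then show ?thesis by (simp only: embed_inject)
qed

lemma trace_zero: "tr 0 = 0"
  using trace_scale[of 0 0] by simp

lemma trace_diff: "tr (x - y) = tr x - tr y"
  using trace_add[of "x - y" y] by (simp add: algebra_simps)

lemma trace_gal:
  assumes g: "g \<in> Gal"
  shows "tr (g x) = tr x"
proof -
  have "(\<Sum>t\<in>Gal. t (g x)) = (\<Sum>t\<in>Gal. t x)"
    by (rule sum.reindex_bij_witness[where j = "\<lambda>t. t \<circ> g" and i = "\<lambda>t. t \<circ> inv\<^bsub>galois_group \<iota>\<^esub> g"])
      (auto simp: g gal_comp fun_eq_iff gal_inv_left gal_inv_right)
  then have "\<iota> (tr (g x)) = \<iota> (tr x)"
    by (simp add: embed_gal_trace)
  then show ?thesis by (simp only: embed_inject)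
qed

text \<open>The hypothesis is a relation between automorphisms with coefficients \<open>g z\<close>,
  and its coefficient at the identity is \<open>z\<close>.\<close>

lemma trace_nondegenerate:
  assumes "\<And>x. tr (z * x) = 0"
  shows "z = 0"
proof -
  have "(\<Sum>g\<in>Gal. g z * g x) = 0" for x
    using embed_gal_trace[of "z * x"] assms[of x] by (simp add: embed_zero gal_times)
  then have "id z = 0"
    using dedekind_independence[OF finite_gal order_refl _ gal_id, of "\<lambda>g. g z"] by blast
  then show ?thesis by simp
qed

text \<open>Both inequalities compare a \<open>K\<close>-basis of the fixed space \<open>V\<close> with the set of right cosets \<open>H g\<close>,
  through the matrix with entries \<open>g\<inverse> u\<close> over \<open>L\<close>.\<close>

lemma dim_fixed_space:
  assumes H: "subgroup H (galois_group \<iota>)"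
  shows "ext.dim {x. \<forall>s\<in>H. s x = x} * card H = card Gal"
proof -
  let ?i = "\<lambda>g. inv\<^bsub>galois_group \<iota>\<^esub> g"
  define V where "V = {x. \<forall>s\<in>H. s x = x}"
  define R where "R = rcosets\<^bsub>galois_group \<iota>\<^esub> H"
  define rep where "rep C = (SOME g. g \<in> C)" for C :: "('l \<Rightarrow> 'l) set"
  have HG: "H \<subseteq> Gal" using H by (rule subgroup.subset)
  have fH: "finite H" using HG finite_gal by (rule finite_subset)
  have cosets: "C \<in> R \<longleftrightarrow> (\<exists>g\<in>Gal. C = H #>\<^bsub>galois_group \<iota>\<^esub> g)" for C
    by (auto simp: R_def RCOSETS_def)
  have rep: "rep C \<in> Gal" "C = H #>\<^bsub>galois_group \<iota>\<^esub> rep C" if C: "C \<in> R" for C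
  proof -
    obtain g where g: "g \<in> Gal" "C = H #>\<^bsub>galois_group \<iota>\<^esub> g"
      using C cosets by blast
    have "g \<in> C" using gal.rcos_self[OF g(1) H] g(2) by simp
    then have "rep C \<in> C" unfolding rep_def by (rule someI[of "\<lambda>g. g \<in> C"])
    then show "C = H #>\<^bsub>galois_group \<iota>\<^esub> rep C"
      using gal.repr_independence[OF _ g(1) H] g(2) by simp
    show "rep C \<in> Gal"
      using \<open>rep C \<in> C\<close> g gal.r_coset_subset_G[OF HG g(1)] by blast
  qed
  have fR: "finite R"
    unfolding R_def RCOSETS_def using finite_gal by simp
  \<comment> \<open>\<open>g\<close> and \<open>rep C\<close> differ by a left factor in
    \<open>H\<close>, which fixes \<open>u\<close>; so the matrix entry depends on the coset
    alone.\<close>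
  have compare: "?i g u = ?i (rep C) u"
    if "C = H #>\<^bsub>galois_group \<iota>\<^esub> g" "g \<in> Gal" "u \<in> V" for C g u
  proof -
    have C: "C \<in> R" using that(1,2) cosets by blast
    then have "g \<in> H #>\<^bsub>galois_group \<iota>\<^esub> rep C"
      using rep(2)[OF C] that(1) gal.rcos_self[OF that(2) H] by simp
    then obtain s where s: "s \<in> H" "g = s \<circ> rep C"
      by (auto simp: r_coset_def gal_mult_eq)
    have sG: "s \<in> Gal" using s(1) HG by blast
    have "g (?i (rep C) u) = u"
      using s(1) that(3) by (simp add: s(2) gal_inv_right rep(1)[OF C] V_def)
    then show ?thesis
      using gal_inv_left[OF that(2)] by metis
  qed
  obtain U where U: "finite U" "U \<subseteq> V" "ext.independent U" "V \<subseteq> ext.span U" "card U = ext.dim V"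
    using finite_basis by blast
  have "card U \<le> card R"
  proof (rule card_le_if_independent[where w = "\<lambda>u C. ?i (rep C) u"], rule fR, rule U(1), rule ballI)
    fix a u assume a: "\<forall>C\<in>R. (\<Sum>u\<in>U. a u * ?i (rep C) u) = 0" and u: "u \<in> U"
    have inv0: "(\<Sum>u\<in>U. a u * ?i g u) = 0" if g: "g \<in> Gal" for g
    proof -
      have "(\<Sum>u\<in>U. a u * ?i g u) = (\<Sum>u\<in>U. a u * ?i (rep (H #>\<^bsub>galois_group \<iota>\<^esub> g)) u)"
        using U(2) compare[OF refl g] by (intro sum.cong) auto
      also have "\<dots> = 0" using a g cosets by blast
      finally show ?thesis .
    qed
    have all0: "(\<Sum>u\<in>U. g (a u) * u) = 0" if g: "g \<in> Gal" for g
    proof -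
      have "g (\<Sum>u\<in>U. a u * ?i g u) = (\<Sum>u\<in>U. g (a u) * u)"
        by (simp add: gal_sum[OF g] gal_times[OF g] gal_inv_right[OF g])
      then show ?thesis using inv0[OF g] gal_zero[OF g] by simp
    qed
    \<comment> \<open>Adding the relations \<open>all0\<close> with weights \<open>g x\<close> gives
      a \<open>K\<close>-linear relation between the elements of \<open>U\<close>, with the
      coefficients \<open>tr (a u * x)\<close>.\<close>
    have "tr (a u * x) = 0" for x
    proof -
      have "(\<Sum>u\<in>U. ext_scale \<iota> (tr (a u * x)) u) = (\<Sum>u\<in>U. \<Sum>g\<in>Gal. g x * (g (a u) * u))"
        by (simp add: ext_scale_def embed_gal_trace gal_times sum_distrib_right sum_distrib_left mult_ac)
      also have "\<dots> = (\<Sum>g\<in>Gal. \<Sum>u\<in>U. g x * (g (a u) * u))"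
        by (rule sum.swap)
      also have "\<dots> = (\<Sum>g\<in>Gal. g x * (\<Sum>u\<in>U. g (a u) * u))"
        by (simp add: sum_distrib_left)
      also have "\<dots> = 0" using all0 by simp
      finally show ?thesis
        using ext.independentD[OF U(3,1) order_refl, of "\<lambda>u. tr (a u * x)" u] u by simp
    qed
    then show "a u = 0" by (rule trace_nondegenerate)
  qed
  moreover have "card R \<le> card U"
  proof (rule card_le_if_spanning[where w = "\<lambda>u C. ?i (rep C) u"], rule fR, rule U(1))
    fix F :: "('l \<Rightarrow> 'l) set \<Rightarrow> 'l"
    obtain c e and N :: nat where
      ce: "\<forall>g\<in>Gal. (\<Sum>i<N. c i * g (e i)) = (if g = id then 1 else 0)"
      using separating_basis by blast
    \<comment> \<open>Summation over \<open>H\<close> maps \<open>L\<close> into \<open>V\<close>,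
      so the elements \<open>T (e i)\<close> have coordinates with respect to
      \<open>U\<close>.\<close>
    define T where "T x = (\<Sum>s\<in>H. s x)" for x
    have "T x \<in> V" for x
    proof -
      have "h (T x) = T x" if h: "h \<in> H" for h
      proof -
        have hG: "h \<in> Gal" using h HG by blast
        have ih: "?i h \<in> H" using H h by (rule subgroup.m_inv_closed)
        have comp: "p \<circ> q \<in> H" if "p \<in> H" "q \<in> H" for p q
          using subgroup.m_closed[OF H that] by (simp add: gal_mult_eq)
        have "h (T x) = (\<Sum>s\<in>H. h (s x))" by (simp add: T_def gal_sum[OF hG])
        also have "\<dots> = T x" unfolding T_def
          by (rule sum.reindex_bij_witness[where j = "\<lambda>t. h \<circ> t" and i = "\<lambda>t. ?i h \<circ> t"])
            (auto simp: h ih comp fun_eq_iff gal_inv_left[OF hG] gal_inv_right[OF hG])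
        finally show ?thesis .
      qed
      then show ?thesis by (simp add: V_def)
    qed
    then have "\<exists>k. T x = (\<Sum>u\<in>U. ext_scale \<iota> (k u) u)" for x
      using U(4) ext.span_finite[OF U(1)] by blast
    then obtain k where k: "\<And>x. T x = (\<Sum>u\<in>U. \<iota> (k x u) * u)"
      unfolding ext_scale_def by metis
    \<comment> \<open>These weights solve the interpolation problem
      \<open>F C = (\<Sum>i<N. b i * ?i (rep C) (T (e i)))\<close>; the coordinates of
      \<open>T (e i)\<close> then express \<open>F\<close> through the elements of
      \<open>U\<close>.\<close>
    define b where "b i = (\<Sum>D\<in>R. F D * ?i (rep D) (c i))" for i
    \<comment> \<open>Pulling the inverse of \<open>rep D\<close> out of the sum leaves the
      separating identity for \<open>?g\<close>. If \<open>?g\<close> is the identity, then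
      \<open>rep C\<close> lies in the coset of \<open>rep D\<close>, hence
      \<open>D = C\<close>.\<close>
    have delta: "(\<Sum>i<N. ?i (rep D) (c i) * ?i (rep C) (s (e i))) = (if D = C \<and> s = id then 1 else 0)"
      if D: "D \<in> R" and C: "C \<in> R" and s: "s \<in> H" for D C s
    proof -
      let ?g = "rep D \<circ> ?i (rep C) \<circ> s"
      have sG: "s \<in> Gal" using s HG by blast
      have gG: "?g \<in> Gal" using rep(1)[OF D] rep(1)[OF C] sG by (intro gal_comp gal.inv_closed)
      have iD: "?i (rep D) \<in> Gal" using rep(1)[OF D] by simp
      have "(\<Sum>i<N. ?i (rep D) (c i) * ?i (rep C) (s (e i))) = ?i (rep D) (\<Sum>i<N. c i * ?g (e i))"
        by (simp add: gal_sum[OF iD] gal_times[OF iD] gal_inv_left[OF rep(1)[OF D]])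
      also have "(\<Sum>i<N. c i * ?g (e i)) = (if ?g = id then 1 else 0)"
        using ce gG by (rule bspec)
      also have "?i (rep D) (if ?g = id then 1 else 0) = (if ?g = id then 1 else 0)"
        by (simp add: gal_zero[OF iD] gal_unit[OF iD])
      also have "?g = id \<longleftrightarrow> D = C \<and> s = id"
      proof
        assume g: "?g = id"
        have "rep C = s \<circ> rep D"
        proof
          fix x
          have "rep D (?i (rep C) (s (rep D x))) = rep D x"
            using fun_cong[OF g, of "rep D x"] by simp
          then have "?i (rep C) (s (rep D x)) = x"
            using gal_inv_left[OF rep(1)[OF D]] by metis
          then show "rep C x = (s \<circ> rep D) x"
            using gal_inv_right[OF rep(1)[OF C]] by (metis comp_apply)
        qed
        then have "rep C \<in> H #>\<^bsub>galois_group \<iota>\<^esub> rep D"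
          using s by (auto simp: r_coset_def gal_mult_eq)
        then have "D = C"
          using gal.repr_independence[OF _ rep(1)[OF D] H] rep(2)[OF D] rep(2)[OF C] by simp
        moreover have "s = id" if "D = C"
          using fun_cong[OF g] gal_inv_right[OF rep(1)[OF C]] that by (auto simp: fun_eq_iff)
        ultimately show "D = C \<and> s = id" by simp
      next
        assume "D = C \<and> s = id"
        then show "?g = id"
          by (auto simp: fun_eq_iff gal_inv_right[OF rep(1)[OF C]])
      qed
      finally show ?thesis .
    qed
    have "F C = (\<Sum>u\<in>U. (\<Sum>i<N. b i * \<iota> (k (e i) u)) * ?i (rep C) u)" if C: "C \<in> R" for C
    proof -
      have iC: "?i (rep C) \<in> Gal" using rep(1)[OF C] by simp
      have id: "id \<in> H" using subgroup.one_closed[OF H] by (simp add: gal_one_eq)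
      have "F C = (\<Sum>D\<in>R. if D = C then F D else 0)"
        using C fR by simp
      also have "\<dots> = (\<Sum>D\<in>R. F D * (\<Sum>s\<in>H. if D = C \<and> s = id then 1 else 0))"
        using fH id by (intro sum.cong) auto
      also have "\<dots> = (\<Sum>D\<in>R. F D * (\<Sum>s\<in>H. \<Sum>i<N. ?i (rep D) (c i) * ?i (rep C) (s (e i))))"
        using delta C by simp
      also have "\<dots> = (\<Sum>D\<in>R. F D * (\<Sum>i<N. \<Sum>s\<in>H. ?i (rep D) (c i) * ?i (rep C) (s (e i))))"
        by (subst sum.swap) (rule refl)
      also have "\<dots> = (\<Sum>D\<in>R. \<Sum>i<N. F D * ?i (rep D) (c i) * ?i (rep C) (T (e i)))"
        by (simp add: T_def gal_sum[OF iC] sum_distrib_left mult.assoc)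
      also have "\<dots> = (\<Sum>i<N. \<Sum>D\<in>R. F D * ?i (rep D) (c i) * ?i (rep C) (T (e i)))"
        by (rule sum.swap)
      also have "\<dots> = (\<Sum>i<N. b i * ?i (rep C) (T (e i)))"
        by (simp add: b_def sum_distrib_right)
      also have "\<dots> = (\<Sum>i<N. \<Sum>u\<in>U. b i * \<iota> (k (e i) u) * ?i (rep C) u)"
        by (simp add: k gal_sum[OF iC] gal_times[OF iC] gal_embed[OF iC] sum_distrib_left mult.assoc)
      also have "\<dots> = (\<Sum>u\<in>U. \<Sum>i<N. b i * \<iota> (k (e i) u) * ?i (rep C) u)"
        by (rule sum.swap)
      also have "\<dots> = (\<Sum>u\<in>U. (\<Sum>i<N. b i * \<iota> (k (e i) u)) * ?i (rep C) u)"
        by (simp add: sum_distrib_right)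
      finally show ?thesis .
    qed
    then show "\<exists>a. \<forall>C\<in>R. F C = (\<Sum>u\<in>U. a u * ?i (rep C) u)"
      by (intro exI[of _ "\<lambda>u. \<Sum>i<N. b i * \<iota> (k (e i) u)"] ballI)
  qed
  ultimately have "ext.dim V = card R" using U(5) by simp
  then show ?thesis
    using gal.lagrange[OF H] by (simp add: V_def R_def Coset.order_def)
qed

lemma ext_degree_eq_card_gal: "ext_degree \<iota> = card Gal"
proof -
  have "ext.dim {x. \<forall>s\<in>{id}. s x = x} * card {id :: 'l \<Rightarrow> 'l} = card Gal"
    using dim_fixed_space[OF gal.triv_subgroup] by (simp only: gal_one_eq)
  then show ?thesis by (simp add: ext_degree_def)
qed

lemma gal_pow_fixed: "g \<in> Gal \<Longrightarrow> g x = x \<Longrightarrow> (g [^]\<^bsub>galois_group \<iota>\<^esub> (j::nat)) x = x"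
  by (induction j) (simp_all add: gal_one_eq gal_mult_eq)

text \<open>An element fixed by \<open>g\<close> is fixed by the cyclic subgroup that
  \<open>g\<close> generates, which has \<open>ord g\<close> elements. As the order is finite,
  powers with natural exponents exhaust this subgroup.\<close>

lemma dim_fixed_by:
  assumes g: "g \<in> Gal"
  shows "ext.dim {x. g x = x} * gal.ord g = ext_degree \<iota>"
proof -
  let ?H = "generate (galois_group \<iota>) {g}"
  have H: "subgroup ?H (galois_group \<iota>)"
    using g by (intro gal.generate_is_subgroup) simp
  have "gal.ord g \<noteq> 0"
    using gal.ord_ge_1[OF finite_gal g] by simp
  then have elems: "?H = {g [^]\<^bsub>galois_group \<iota>\<^esub> j | j. j \<in> (UNIV :: nat set)}"
    using gal.generate_pow_nat[OF g] by simp
  have "g \<in> ?H" by (rule generate.incl) simp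
  then have "{x. \<forall>s\<in>?H. s x = x} = {x. g x = x}"
    using gal_pow_fixed[OF g] by (auto simp: elems)
  then show ?thesis
    using dim_fixed_space[OF H] gal.generate_pow_card[OF g] ext_degree_eq_card_gal by simp
qed

end

section \<open>Radicals of Galois forms\<close>

context finite_galois_extension
begin

text \<open>Invariance of the trace under the inverse of \<open>g\<close> moves the automorphism in
  the second summand from \<open>x\<close> to \<open>y\<close>. Both summands then have the shape
  \<open>tr (a * x * h y)\<close>, in which forms can be compared.\<close>

lemma galois_form_swap:
  assumes g: "g \<in> Gal"
  shows "galois_form \<iota> b g x y =
    tr (b * x * g y) - tr ((inv\<^bsub>galois_group \<iota>\<^esub> g) b * x * (inv\<^bsub>galois_group \<iota>\<^esub> g) y)"
proof -
  let ?h = "inv\<^bsub>galois_group \<iota>\<^esub> g"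
  have h: "?h \<in> Gal" using g by simp
  have "tr (b * (g x * y)) = tr (?h (b * (g x * y)))"
    by (simp only: trace_gal[OF h])
  also have "?h (b * (g x * y)) = ?h b * x * ?h y"
    by (simp add: gal_times[OF h] gal_inv_left[OF g] mult.assoc)
  finally show ?thesis
    by (simp add: galois_form_def trace_diff right_diff_distrib mult.assoc)
qed

text \<open>Invariance of the trace, now used on the first summand, frees \<open>y\<close>; the
  radical can then be read off from the nondegeneracy of the trace.\<close>

lemma galois_form_adjoint:
  assumes g: "g \<in> Gal"
  shows "galois_form \<iota> b g x y = tr (((inv\<^bsub>galois_group \<iota>\<^esub> g) (b * x) - b * g x) * y)"
proof -
  let ?h = "inv\<^bsub>galois_group \<iota>\<^esub> g"
  have h: "?h \<in> Gal" using g by simp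
  have "tr (b * (x * g y)) = tr (?h (b * (x * g y)))"
    by (simp only: trace_gal[OF h])
  also have "?h (b * (x * g y)) = ?h (b * x) * y"
    by (simp add: gal_times[OF h] gal_inv_left[OF g] mult.assoc)
  finally show ?thesis
    by (simp add: galois_form_def trace_diff right_diff_distrib left_diff_distrib mult.assoc)
qed

lemma mem_radical_galois_form_iff:
  assumes g: "g \<in> Gal"
  shows "x \<in> form_radical (galois_form \<iota> b g) \<longleftrightarrow> b * x = g b * g (g x)"
proof -
  let ?h = "inv\<^bsub>galois_group \<iota>\<^esub> g"
  have "x \<in> form_radical (galois_form \<iota> b g) \<longleftrightarrow> ?h (b * x) - b * g x = 0"
    using trace_nondegenerate[of "?h (b * x) - b * g x"]
    by (auto simp: form_radical_def galois_form_adjoint[OF g] trace_zero)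
  also have "\<dots> \<longleftrightarrow> ?h (b * x) = b * g x" by simp
  also have "\<dots> \<longleftrightarrow> g (?h (b * x)) = g (b * g x)"
    using gal_bij[OF g] by (metis bij_is_inj inj_eq)
  finally show ?thesis by (simp add: gal_inv_right[OF g] gal_times[OF g])
qed

lemma galois_form_eq_zero_iff:
  assumes g: "g \<in> Gal"
  shows "galois_form \<iota> b g = 0 \<longleftrightarrow> (\<forall>x. b * x = g b * g (g x))"
proof -
  have "galois_form \<iota> b g = 0 \<longleftrightarrow> (\<forall>x. x \<in> form_radical (galois_form \<iota> b g))"
    by (auto simp: form_radical_def fun_eq_iff)
  then show ?thesis by (simp only: mem_radical_galois_form_iff[OF g])
qed

text \<open>If the radical is everything, it contains \<open>1\<close>, so \<open>g b = b\<close>;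
  cancelling \<open>b\<close> in the radical condition leaves \<open>g (g x) = x\<close> for all
  \<open>x\<close>.\<close>

lemma galois_form_nonzero:
  assumes g: "g \<in> Gal" and gg: "g \<circ> g \<noteq> id" and b: "b \<noteq> 0"
  shows "galois_form \<iota> b g \<noteq> 0"
proof
  assume "galois_form \<iota> b g = 0"
  then have *: "b * x = g b * g (g x)" for x by (simp add: galois_form_eq_zero_iff[OF g])
  from *[of 1] have "b = g b" by (simp add: gal_unit[OF g])
  with * b have "g (g x) = x" for x by (metis mult_cancel_left)
  with gg show False by (auto simp: fun_eq_iff)
qed

lemma galois_form_add: "galois_form \<iota> (b + c) g = galois_form \<iota> b g + galois_form \<iota> c g"
  by (simp add: galois_form_def fun_eq_iff trace_add distrib_right)

lemma galois_form_diff: "galois_form \<iota> (b - c) g = galois_form \<iota> b g - galois_form \<iota> c g"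
  by (simp add: galois_form_def fun_eq_iff trace_diff left_diff_distrib)

lemma galois_form_scale: "galois_form \<iota> (ext_scale \<iota> k b) g = form_scale k (galois_form \<iota> b g)"
  by (simp add: galois_form_def form_scale_def ext_scale_def fun_eq_iff trace_scale mult.assoc)

section \<open>Dimensions of radicals\<close>

lemma form_rank_full:
  assumes "form_radical f = {0}"
  shows "form_rank \<iota> f = ext_degree \<iota>"
proof -
  have "ext.dim {0} \<le> card ({} :: 'l set)"
    by (rule ext.dim_le_card) auto
  then show ?thesis by (simp add: form_rank_def assms)
qed

lemma zero_mem_radical: "g \<in> Gal \<Longrightarrow> 0 \<in> form_radical (galois_form \<iota> b g)"
  by (simp add: mem_radical_galois_form_iff gal_zero)

lemma subspace_fixed:
  assumes g: "g \<in> Gal"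
  shows "ext.subspace {x. g x = x}"
  by (rule ext.subspaceI)
    (auto simp: ext_scale_def gal_add[OF g] gal_zero[OF g] gal_times[OF g] gal_embed[OF g])

text \<open>The quotient of two non-zero elements of the radical is fixed by
  \<open>g \<circ> g\<close>, so the radical is \<open>x\<close> times the fixed field of
  \<open>g \<circ> g\<close>.\<close>

lemma dim_radical:
  assumes g: "g \<in> Gal" and b: "b \<noteq> 0"
    and x: "x \<in> form_radical (galois_form \<iota> b g)" "x \<noteq> 0"
  shows "ext.dim (form_radical (galois_form \<iota> b g)) = ext.dim {z. g (g z) = z}"
proof -
  let ?E = "{z. g (g z) = z}"
  have gg: "g \<circ> g \<in> Gal" using gal_comp[OF g g] .
  have bx: "b * x = g b * g (g x)" using x(1) mem_radical_galois_form_iff[OF g] by simp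
  have nz: "g b \<noteq> 0" "g (g x) \<noteq> 0" using b x(2) by (simp_all add: gal_eq_zero_iff[OF g])
  have "form_radical (galois_form \<iota> b g) = (\<lambda>z. x * z) ` ?E"
  proof (intro equalityI subsetI)
    fix y assume "y \<in> form_radical (galois_form \<iota> b g)"
    then have y_eq: "b * y = g b * g (g y)" using mem_radical_galois_form_iff[OF g] by simp
    have "b * y * g (g x) = g b * g (g x) * g (g y)" by (simp only: y_eq mult_ac)
    also have "\<dots> = b * x * g (g y)" by (simp only: bx)
    finally have "y * g (g x) = x * g (g y)" using b by simp
    then have "g (g (y / x)) = y / x"
      using nz x(2) by (simp add: gal_divide[OF g] field_simps)
    then show "y \<in> (\<lambda>z. x * z) ` ?E"
      using x(2) by (intro image_eqI[of _ _ "y / x"]) auto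
  next
    fix y assume "y \<in> (\<lambda>z. x * z) ` ?E"
    then show "y \<in> form_radical (galois_form \<iota> b g)"
      using bx by (auto simp: mem_radical_galois_form_iff[OF g] gal_times[OF g])
  qed
  moreover have "ext.dim ((\<lambda>z. x * z) ` ?E) = ext.dim ?E"
    using subspace_fixed[OF gg] x(2)
    by (intro dim_linear_image ext.vector_space_axioms)
      (auto simp: ext_scale_def distrib_left inj_on_def)
  ultimately show ?thesis by simp
qed

section \<open>Existence of non-zero and of zero radicals, according to the parity of the
  order\<close>

lemma gal_nat_pow: "g \<in> Gal \<Longrightarrow> g [^]\<^bsub>galois_group \<iota>\<^esub> (j::nat) = g ^^ j"
  by (induction j) (auto simp: gal_one_eq gal_mult_eq fun_eq_iff funpow_swap1)

lemma gal_funpow: "g \<in> Gal \<Longrightarrow> g ^^ j \<in> Gal"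
  using gal.nat_pow_closed[of g j] by (simp add: gal_nat_pow)

lemma funpow_ord: "g \<in> Gal \<Longrightarrow> g ^^ gal.ord g = id"
  using gal.pow_ord_eq_1[of g] by (simp only: gal_nat_pow gal_one_eq)

lemma funpow_eq_id_iff: "g \<in> Gal \<Longrightarrow> g ^^ j = id \<longleftrightarrow> gal.ord g dvd j"
  using gal.pow_eq_id[of g j] by (simp only: gal_nat_pow gal_one_eq)

lemma ord_comp_self:
  assumes g: "g \<in> Gal"
  shows "gal.ord (g \<circ> g) = gal.ord g div gcd (gal.ord g) 2"
  using gal.ord_pow_gen[OF g, of 2]
  by (simp only: gal_nat_pow[OF g]) (simp add: numeral_2_eq_2)

text \<open>With \<open>s = g\<^sup>2\<close> the automorphism \<open>g\<close> is \<open>s\<^bsup>r+1\<^esup>\<close>, so for \<open>d = b \<cdot> s b \<cdots> s\<^sup>r b\<close> the quotient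
  \<open>s d / d\<close> is \<open>g b / b\<close>, and \<open>1 / d\<close> lies in the radical.\<close>

lemma radical_nonzero_if_odd:
  assumes g: "g \<in> Gal" and ord: "gal.ord g = 2 * r + 1" and b: "b \<noteq> 0"
  shows "\<exists>x. x \<in> form_radical (galois_form \<iota> b g) \<and> x \<noteq> 0"
proof -
  define s where "s = g \<circ> g"
  have s: "s \<in> Gal" using gal_comp[OF g g] by (simp add: s_def)
  define d where "d j = (\<Prod>i<j. (s ^^ i) b)" for j
  have step: "s (d j) * b = (s ^^ j) b * d j" for j
  proof (induction j)
    case 0
    then show ?case by (simp add: d_def gal_unit[OF s])
  next
    case (Suc j)
    have "s (d (Suc j)) * b = s (d j) * b * (s ^^ Suc j) b"
      by (simp add: d_def gal_times[OF s])
    also have "\<dots> = (s ^^ Suc j) b * d (Suc j)"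
      using Suc.IH by (simp add: d_def)
    finally show ?case .
  qed
  have "s ^^ (r + 1) = (g ^^ 2) ^^ (r + 1)"
    by (simp add: s_def numeral_2_eq_2)
  also have "\<dots> = g ^^ Suc (2 * r + 1)"
    by (simp only: funpow_mult) (simp add: mult.commute)
  also have "\<dots> = g"
    using funpow_ord[OF g] by (simp only: ord funpow.simps) simp
  finally have sd: "s (d (r + 1)) * b = g b * d (r + 1)"
    using step[of "r + 1"] by simp
  have "(s ^^ i) b \<noteq> 0" for i
    using b gal_eq_zero_iff[OF gal_funpow[OF s]] by simp
  then have d0: "d (r + 1) \<noteq> 0" by (simp add: d_def)
  have "b * (1 / d (r + 1)) = g b * s (1 / d (r + 1))"
    using sd d0 gal_eq_zero_iff[OF s] by (simp add: gal_divide[OF s] gal_unit[OF s] field_simps)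
  then have "1 / d (r + 1) \<in> form_radical (galois_form \<iota> b g)"
    by (simp add: mem_radical_galois_form_iff[OF g] s_def)
  with d0 show ?thesis by (intro exI[of _ "1 / d (r + 1)"]) simp
qed

text \<open>On the multiplicative group of \<open>L\<close> the map \<open>f\<close> is an
  endomorphism, and each of its fibres is a translate of the kernel.\<close>

lemma card_eq_card_image_mult_card_kernel:
  assumes fin: "finite (UNIV :: 'l set)"
    and nz: "\<And>x. x \<noteq> 0 \<Longrightarrow> f x \<noteq> (0::'l)" and mult: "\<And>x y. f (x * y) = f x * f (y :: 'l)"
  shows "card (- {0 :: 'l}) = card (f ` (- {0})) * card {x. x \<noteq> 0 \<and> f x = 1}"
proof -
  have "card {x \<in> - {0}. f x = y} = card {x. x \<noteq> 0 \<and> f x = 1}" if y: "y \<in> f ` (- {0})" for y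
  proof -
    obtain z where z: "z \<noteq> 0" "y = f z" using y by auto
    have "{x \<in> - {0}. f x = y} = (\<lambda>x. z * x) ` {x. x \<noteq> 0 \<and> f x = 1}"
    proof (intro equalityI subsetI)
      fix x assume x: "x \<in> {x \<in> - {0}. f x = y}"
      then have "f z * f (x / z) = f z * 1"
        using z mult[of z "x / z"] by simp
      then have "f (x / z) = 1" using nz[OF z(1)] by (simp only: mult_cancel_left) simp
      then show "x \<in> (\<lambda>x. z * x) ` {x. x \<noteq> 0 \<and> f x = 1}"
        using x z(1) by (intro image_eqI[of _ _ "x / z"]) auto
    qed (use z mult in auto)
    then show ?thesis using z(1) by (simp add: card_image inj_on_def)
  qed
  moreover have "card (- {0 :: 'l}) = (\<Sum>y\<in>f ` (- {0}). card {x \<in> - {0}. f x = y})"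
    using sum.image_gen[of "- {0}" "\<lambda>_. 1::nat" f] finite_subset[OF subset_UNIV fin]
    by simp
  ultimately show ?thesis by simp
qed

lemma finite_ext_if_finite_base:
  assumes "finite (UNIV :: 'k set)"
  shows "finite (UNIV :: 'l set)"
proof -
  obtain U where U: "finite U" "(UNIV :: 'l set) \<subseteq> ext.span U"
    using finite_basis by blast
  have "(UNIV :: 'l set) \<subseteq> (\<lambda>k. \<Sum>u\<in>U. ext_scale \<iota> (k u) u) ` (\<Pi>\<^sub>E u\<in>U. (UNIV :: 'k set))"
  proof
    fix x :: 'l
    obtain k where "x = (\<Sum>u\<in>U. ext_scale \<iota> (k u) u)"
      using U by (auto simp: ext.span_finite)
    then have "x = (\<Sum>u\<in>U. ext_scale \<iota> (restrict k U u) u)"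
      by simp
    then show "x \<in> (\<lambda>k. \<Sum>u\<in>U. ext_scale \<iota> (k u) u) ` (\<Pi>\<^sub>E u\<in>U. (UNIV :: 'k set))"
      by (rule image_eqI[where x = "restrict k U"]) simp
  qed
  moreover have "finite (\<Pi>\<^sub>E u\<in>U. (UNIV :: 'k set))"
    using U(1) assms by (rule finite_PiE)
  ultimately show ?thesis by (meson finite_imageI finite_subset)
qed

text \<open>The order of \<open>g \<circ> g\<close> is half that of \<open>g\<close>, so its fixed
  space has twice the dimension, and this dimension is positive.\<close>

lemma fixed_psubset_if_even:
  assumes g: "g \<in> Gal" and ev: "even (gal.ord g)"
  shows "\<exists>x. g (g x) = x \<and> g x \<noteq> x"
proof (rule ccontr)
  assume "\<nexists>x. g (g x) = x \<and> g x \<noteq> x"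
  then have eq: "{x. (g \<circ> g) x = x} = {x. g x = x}"
    by (metis comp_apply)
  have pos: "gal.ord g \<ge> 1" using gal.ord_ge_1[OF finite_gal g] .
  obtain r where r: "gal.ord g = 2 * r" using ev by (elim evenE)
  have "gal.ord (g \<circ> g) = r"
    using pos by (simp add: ord_comp_self[OF g] r)
  then have "ext.dim {x. g x = x} * r = ext.dim {x. g x = x} * (2 * r)"
    using dim_fixed_by[OF g] dim_fixed_by[OF gal_comp[OF g g]] unfolding eq by (simp add: r)
  then have "ext.dim {x. g x = x} = 0" using pos r by simp
  then have "ext_degree \<iota> = 0" using dim_fixed_by[OF g] by simp
  then show False
    using ext_degree_eq_card_gal finite_gal gal_id by auto
qed

text \<open>If every \<open>b\<close> had a non-zero radical, all quotients \<open>b / g b\<close> would be of the form \<open>g\<^sup>2 x / x\<close>;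
  but there are fewer of the latter, since \<open>g\<^sup>2\<close> fixes more elements than \<open>g\<close>.\<close>

lemma radical_zero_exists_finite:
  assumes fin: "finite (UNIV :: 'l set)" and g: "g \<in> Gal" and ev: "even (gal.ord g)"
  shows "\<exists>b. b \<noteq> 0 \<and> (\<forall>x. b * x = g b * g (g x) \<longrightarrow> x = 0)"
proof (rule ccontr)
  assume "\<nexists>b. b \<noteq> 0 \<and> (\<forall>x. b * x = g b * g (g x) \<longrightarrow> x = 0)"
  then have *: "\<exists>x. b * x = g b * g (g x) \<and> x \<noteq> 0" if "b \<noteq> 0" for b
    using that by blast
  define p where "p b = b / g b" for b
  define q where "q x = g (g x) / x" for x
  let ?M = "- {0 :: 'l}"
  have nz: "g x = 0 \<longleftrightarrow> x = 0" for x by (rule gal_eq_zero_iff[OF g])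
  have sub: "p ` ?M \<subseteq> q ` ?M"
  proof
    fix y assume "y \<in> p ` ?M"
    then obtain b where b: "b \<noteq> 0" "y = b / g b" by (auto simp: p_def)
    then obtain x where x: "b * x = g b * g (g x)" "x \<noteq> 0" using * by blast
    then have "g (g x) = b * x / g b" using b by (simp add: nz eq_divide_eq mult.commute)
    then have "y = q x" using b x(2) by (simp add: q_def)
    with x(2) show "y \<in> q ` ?M" by blast
  qed
  have finM: "finite A" for A :: "'l set" using fin by (rule finite_subset[OF subset_UNIV])
  let ?P = "{x. x \<noteq> 0 \<and> p x = 1}" and ?Q = "{x. x \<noteq> 0 \<and> q x = 1}"
  have P: "card ?M = card (p ` ?M) * card ?P"
    by (rule card_eq_card_image_mult_card_kernel[OF fin]) (auto simp: p_def nz gal_times[OF g])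
  have Q: "card ?M = card (q ` ?M) * card ?Q"
    by (rule card_eq_card_image_mult_card_kernel[OF fin]) (auto simp: q_def nz gal_times[OF g])
  obtain z where z: "g (g z) = z" "g z \<noteq> z"
    using fixed_psubset_if_even[OF g ev] by blast
  \<comment> \<open>The kernels of \<open>p\<close> and \<open>q\<close> consist of the non-zero
    elements fixed by \<open>g\<close> and by \<open>g \<circ> g\<close>; \<open>z\<close> shows
    that the second is larger.\<close>
  have P': "?P = {x. x \<noteq> 0 \<and> g x = x}" by (auto simp: p_def nz)
  have Q': "?Q = {x. x \<noteq> 0 \<and> g (g x) = x}" by (auto simp: q_def)
  have "?P \<subset> ?Q"
    unfolding P' Q' using z gal_zero[OF g] by (intro psubsetI) auto
  then have lt: "card ?P < card ?Q" using finM by (rule psubset_card_mono[rotated])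
  have "card ?M \<le> card (q ` ?M) * card ?P"
    unfolding P using card_mono[OF finM sub] by simp
  moreover have "1 \<in> ?M" by simp
  then have "card (q ` ?M) > 0"
    using finM by (subst card_gt_0_iff) blast
  ultimately have "card ?M < card ?M"
    using lt Q by (metis (no_types, lifting) mult_less_cancel1 order_le_less_trans)
  then show False by simp
qed

text \<open>With the order written as \<open>u * 2 ^ a\<close>, \<open>u\<close> odd, any element
  moved by \<open>g ^^ u\<close> will do: an odd \<open>j\<close> is invertible modulo
  \<open>2 ^ a\<close>, and multiplying the Bezout identity by \<open>u\<close> shows that
  \<open>g ^^ u\<close> is a power of \<open>g ^^ j\<close>.\<close>

lemma not_fixed_by_odd_powers:
  assumes g: "g \<in> Gal" and ev: "even (gal.ord g)"
  shows "\<exists>b. \<forall>j. odd j \<longrightarrow> (g ^^ j) b \<noteq> b"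
proof -
  have "gal.ord g \<noteq> 0" using gal.ord_ge_1[OF finite_gal g] by simp
  then obtain u where "odd u" "gal.ord g = 2 ^ multiplicity 2 (gal.ord g) * u"
    using multiplicity_decompose'[of "gal.ord g" 2] by auto
  then obtain a where u: "odd u" "gal.ord g = u * 2 ^ a"
    by (metis mult.commute)
  have "g ^^ u \<noteq> id"
    using u ev odd_pos[OF u(1)] by (auto simp: funpow_eq_id_iff[OF g])
  then obtain b where b: "(g ^^ u) b \<noteq> b" by (auto simp: fun_eq_iff)
  have "(g ^^ j) b \<noteq> b" if j: "odd j" for j
  proof
    assume jb: "(g ^^ j) b = b"
    have "coprime j (2 ^ a)" using j by simp
    then obtain c q where cq: "j * c = 2 ^ a * q + 1"
      using bezout_nat[of j "2 ^ a"] j by (auto simp: coprime_iff_gcd_eq_1)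
    have pw: "(h ^^ i) b = b" if "h b = b" for h :: "'l \<Rightarrow> 'l" and i
      using that by (induction i) auto
    have "(g ^^ (j * (c * u))) b = b"
      using pw[of "g ^^ j" "c * u", OF jb] by (simp add: funpow_mult)
    moreover have "g ^^ (j * (c * u)) = g ^^ u"
    proof -
      have "j * (c * u) = u + gal.ord g * q"
        using cq by (simp add: u(2) algebra_simps flip: mult.assoc)
      then show ?thesis
        using funpow_ord[OF g] by (simp add: funpow_add flip: funpow_mult)
    qed
    ultimately show False using b by simp
  qed
  then show ?thesis by blast
qed

text \<open>With \<open>s = g\<^sup>2\<close> of order \<open>r\<close> and \<open>N y = y \<cdot> s y \<cdots> s\<^bsup>r-1\<^esup> y\<close>, a non-zero radical for \<open>b + t\<close> forces
  \<open>N (b + t) = N (g (b + t))\<close>. If this held for all but finitely many \<open>t \<in> K\<close>, it would be an identity of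
  polynomials in \<open>t\<close>, whose root \<open>- b\<close> on the left would be fixed by an odd power of \<open>g\<close>.\<close>

lemma radical_zero_exists_infinite:
  assumes inf: "infinite (UNIV :: 'k set)" and g: "g \<in> Gal" and ev: "even (gal.ord g)"
  shows "\<exists>b. b \<noteq> 0 \<and> (\<forall>x. b * x = g b * g (g x) \<longrightarrow> x = 0)"
proof (rule ccontr)
  assume "\<nexists>b. b \<noteq> 0 \<and> (\<forall>x. b * x = g b * g (g x) \<longrightarrow> x = 0)"
  then have *: "\<exists>x. b * x = g b * g (g x) \<and> x \<noteq> 0" if "b \<noteq> 0" for b
    using that by blast
  obtain r where r: "gal.ord g = 2 * r" using ev by (elim evenE)
  have r0: "r > 0" using gal.ord_ge_1[OF finite_gal g] r by simp
  obtain b where b: "\<And>j. odd j \<Longrightarrow> (g ^^ j) b \<noteq> b"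
    using not_fixed_by_odd_powers[OF g ev] by blast
  define s where "s = g \<circ> g"
  have sG: "s ^^ i \<in> Gal" for i using gal_funpow[OF gal_comp[OF g g]] by (simp add: s_def)
  have "s = g ^^ 2" by (simp add: s_def numeral_2_eq_2)
  then have s_pow: "s ^^ i = g ^^ (2 * i)" for i
    by (simp add: funpow_mult mult.commute)
  define N where "N y = (\<Prod>i<r. (s ^^ i) y)" for y
  have N_mult: "N (x * y) = N x * N y" for x y
    by (simp add: N_def gal_times[OF sG] prod.distrib)
  \<comment> \<open>As \<open>s ^^ r = id\<close>, the automorphism \<open>s\<close> permutes the
    factors cyclically. Multiplying by \<open>x\<close> turns both sides into the product of
    \<open>r + 1\<close> consecutive factors; \<open>x = 0\<close> is treated apart because
    \<open>x\<close> is cancelled afterwards.\<close>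
  have N_s: "N (s x) = N x" for x
  proof -
    have "N (s x) = (\<Prod>i<r. (s ^^ Suc i) x)"
      by (simp add: N_def funpow_swap1)
    also have "\<dots> * x = (\<Prod>i<Suc r. (s ^^ i) x)"
      by (subst prod.lessThan_Suc_shift) (simp add: mult.commute)
    also have "\<dots> = N x * x"
      using funpow_ord[OF g] by (simp add: N_def s_pow r)
    finally show ?thesis by (cases "x = 0") (simp_all add: s_def gal_zero[OF g])
  qed
  have N_nz: "N x \<noteq> 0" if "x \<noteq> 0" for x
    using that by (simp add: N_def gal_eq_zero_iff[OF sG])
  have N_g: "N y = N (g y)" if y: "y \<noteq> 0" for y
  proof -
    obtain x where x: "y * x = g y * g (g x)" "x \<noteq> 0" using *[OF y] by blast
    have "N y * N x = N (g y) * N (s x)"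
      using x(1) by (simp add: s_def flip: N_mult)
    then show ?thesis using N_nz[OF x(2)] by (simp add: N_s)
  qed
  define P where "P = (\<Prod>i<r. [:(s ^^ i) b, 1:])"
  define Q where "Q = (\<Prod>i<r. [:(s ^^ i) (g b), 1:])"
  have "poly P (\<iota> k) = N (b + \<iota> k)" "poly Q (\<iota> k) = N (g (b + \<iota> k))" for k
    by (simp_all add: P_def Q_def N_def poly_prod gal_add[OF sG] gal_embed[OF sG]
        gal_add[OF g] gal_embed[OF g])
  then have "poly (P - Q) (\<iota> k) = 0" if "\<iota> k \<noteq> - b" for k
    using N_g[of "b + \<iota> k"] that by (simp add: add_eq_0_iff)
  \<comment> \<open>The point \<open>- b\<close> is left out because \<open>N_g\<close> needs a
    non-zero argument; infinitely many roots remain.\<close>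
  then have "range \<iota> - {- b} \<subseteq> {x. poly (P - Q) x = 0}"
    by auto
  moreover have "infinite (range \<iota> - {- b})"
    using inf embed_inject by (auto simp: finite_image_iff inj_on_def)
  ultimately have "infinite {x. poly (P - Q) x = 0}"
    using finite_subset by blast
  then have "P = Q" using poly_roots_finite[of "P - Q"] by auto
  \<comment> \<open>The factor with \<open>i = 0\<close> vanishes at \<open>- b\<close>; it is
    present because \<open>r > 0\<close>.\<close>
  moreover have "poly P (- b) = 0"
    using r0 by (auto simp: P_def poly_prod intro!: bexI[of _ 0])
  ultimately have "poly Q (- b) = 0" by simp
  then obtain i where "(s ^^ i) (g b) = b"
    by (auto simp: Q_def poly_prod)
  then have "(g ^^ (2 * i + 1)) b = b"
    by (simp add: s_pow funpow_swap1)
  then show False using b[of "2 * i + 1"] by simp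
qed

lemma radical_zero_exists:
  assumes g: "g \<in> Gal" and ev: "even (gal.ord g)"
  shows "\<exists>b. b \<noteq> 0 \<and> form_radical (galois_form \<iota> b g) = {0}"
proof -
  obtain b where b: "b \<noteq> 0" "\<forall>x. b * x = g b * g (g x) \<longrightarrow> x = 0"
    using radical_zero_exists_finite[OF _ assms] radical_zero_exists_infinite[OF _ assms]
      finite_ext_if_finite_base by blast
  then have "form_radical (galois_form \<iota> b g) = {0}"
    using mem_radical_galois_form_iff[OF g] zero_mem_radical[OF g] by blast
  with b(1) show ?thesis by blast
qed

end

section \<open>Decomposition of the space of alternating forms\<close>

text \<open>Off the diagonal the terms cancel in pairs. The diagonal has a condition of its own
  because \<open>A i i = - A i i\<close> does not force it to vanish in characteristic 2.\<close>

lemma sum_alternating_eq_zero: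
  fixes A :: "nat \<Rightarrow> nat \<Rightarrow> 'a::ab_group_add"
  assumes skew: "\<And>i j. A i j = - A j i" and diag: "\<And>i. A i i = 0"
  shows "(\<Sum>i<N. \<Sum>j<N. A i j) = 0"
proof (induction N)
  case (Suc N)
  have "(\<Sum>i<N. A i N) = - (\<Sum>j<N. A N j)"
    by (subst skew) (simp add: sum_negf)
  with Suc show ?case by (simp add: sum.distrib diag)
qed simp

lemma sum_form_apply: "(\<Sum>i\<in>I. v i) x y = (\<Sum>i\<in>I. v i x y)"
  for v :: "'i \<Rightarrow> 'a \<Rightarrow> 'b \<Rightarrow> 'c::ab_group_add"
  by (induction I rule: infinite_finite_induct) simp_all

context finite_galois_extension
begin

section \<open>Alternating forms as sums of traces\<close>

lemma Alt_iff:
  "f \<in> Alt \<iota> \<longleftrightarrow>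
    (\<forall>x x' y. f (x + x') y = f x y + f x' y) \<and> (\<forall>c x y. f (\<iota> c * x) y = c * f x y) \<and>
    (\<forall>x y y'. f x (y + y') = f x y + f x y') \<and> (\<forall>c x y. f x (\<iota> c * y) = c * f x y) \<and>
    (\<forall>x. f x x = 0)"
proof -
  have "vector_space ((*) :: 'k \<Rightarrow> 'k \<Rightarrow> 'k)"
    by unfold_locales (simp_all add: algebra_simps)
  then show ?thesis
    using ext.vector_space_axioms
    by (auto simp: Alt_def Vector_Spaces.linear_iff ext_scale_def)
qed

lemma Alt_subspace: "module.subspace form_scale (Alt \<iota>)"
proof -
  interpret F: vector_space form_scale by (rule vector_space_form_scale)
  show ?thesis
    by (rule F.subspaceI) (auto simp: Alt_iff form_scale_def algebra_simps)
qed

lemma galois_form_Alt: "g \<in> Gal \<Longrightarrow> galois_form \<iota> b g \<in> Alt \<iota>"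
  unfolding Alt_iff galois_form_def
  by (auto simp: gal_add gal_times gal_embed mult.commute trace_zero
      simp flip: trace_add trace_scale intro!: arg_cong[where f = tr])
    (simp_all add: algebra_simps)

lemma galois_forms_subspace: "module.subspace form_scale (range (\<lambda>b. galois_form \<iota> b g))"
proof -
  interpret F: vector_space form_scale by (rule vector_space_form_scale)
  have "galois_form \<iota> 0 g = 0"
    using galois_form_diff[of 0 0 g] by simp
  then show ?thesis
    by (intro F.subspaceI)
      (auto simp flip: galois_form_add galois_form_scale intro: range_eqI[of _ _ 0])
qed

text \<open>Applying \<open>g\<close> to the separating identity for the inverse of \<open>g\<close>
  shows that \<open>\<Sum>i<N. g (c i) * e i\<close> also singles out the identity. Hence only the
  term with \<open>g = id\<close> survives when the traces are written out.\<close>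

lemma trace_expansion:
  assumes "\<forall>g\<in>Gal. (\<Sum>i<N. c i * g (e i)) = (if g = id then 1 else 0)"
  shows "x = (\<Sum>i<N. \<iota> (tr (c i * x)) * e i)"
proof -
  have 1: "(\<Sum>i<N. g (c i) * e i) = (if g = id then 1 else 0)" if g: "g \<in> Gal" for g
  proof -
    let ?h = "inv\<^bsub>galois_group \<iota>\<^esub> g"
    have h: "?h \<in> Gal" using g by simp
    have "(\<Sum>i<N. g (c i) * e i) = g (\<Sum>i<N. c i * ?h (e i))"
      by (simp add: gal_sum[OF g] gal_times[OF g] gal_inv_right[OF g])
    also have "(\<Sum>i<N. c i * ?h (e i)) = (if ?h = id then 1 else 0)"
      using assms h by (rule bspec)
    also have "?h = id \<longleftrightarrow> g = id"
      using gal.inv_eq_1_iff[OF g] by (simp only: gal_one_eq)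
    also have "g (if g = id then 1 else 0) = (if g = id then 1 else 0)"
      by (simp add: gal_zero[OF g])
    finally show ?thesis .
  qed
  have "(\<Sum>i<N. \<iota> (tr (c i * x)) * e i) = (\<Sum>i<N. \<Sum>g\<in>Gal. g x * (g (c i) * e i))"
    by (simp add: embed_gal_trace gal_times sum_distrib_right sum_distrib_left mult_ac)
  also have "\<dots> = (\<Sum>g\<in>Gal. \<Sum>i<N. g x * (g (c i) * e i))"
    by (rule sum.swap)
  also have "\<dots> = (\<Sum>g\<in>Gal. g x * (if g = id then 1 else 0))"
    by (simp add: 1 flip: sum_distrib_left)
  also have "\<dots> = (\<Sum>g\<in>Gal. if g = id then g x else 0)"
    by (intro sum.cong) auto
  also have "\<dots> = x" using finite_gal gal_id by simp
  finally show ?thesis by simp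
qed

text \<open>Expanding both arguments of \<open>f\<close> in traces gives \<open>f x y = \<Sum> C g h \<cdot> g x \<cdot> h y\<close> over all pairs \<open>g\<close>, \<open>h\<close>, and
  grouping the pairs by \<open>g\<inverse> h\<close> turns this into a sum of traces.\<close>

lemma Alt_expansion:
  assumes f: "f \<in> Alt \<iota>"
  shows "\<exists>a. a id = 0 \<and> (\<forall>g\<in>Gal. a (inv\<^bsub>galois_group \<iota>\<^esub> g) = - (inv\<^bsub>galois_group \<iota>\<^esub> g) (a g)) \<and>
    (\<forall>x y. f x y = (\<Sum>g\<in>Gal. tr (a g * x * g y)))"
proof -
  obtain c e and N :: nat where
    ce: "\<forall>g\<in>Gal. (\<Sum>i<N. c i * g (e i)) = (if g = id then 1 else 0)"
    using separating_basis by blast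
  have f_add: "f (x + x') y = f x y + f x' y" "f y (x + x') = f y x + f y x'"
    and f_scale: "f (\<iota> k * x) y = k * f x y" "f y (\<iota> k * x) = k * f y x"
    and f_diag: "f x x = 0" for x x' y k
    using f by (auto simp: Alt_iff)
  have f_zero: "f 0 y = 0" "f y 0 = 0" for y
    using f_scale(1)[where k = 0 and y = y] f_scale(2)[where k = 0 and y = y]
    by (simp_all add: embed_zero)
  have f_skew: "f x y = - f y x" for x y
  proof -
    have "f (x + y) (x + y) = f x y + f y x"
      by (simp only: f_add) (simp add: f_diag)
    then show ?thesis by (metis f_diag eq_neg_iff_add_eq_0)
  qed
  have f_sum: "f (\<Sum>i<M. \<iota> (k i) * z i) y = (\<Sum>i<M. k i * f (z i) y)"
    "f y (\<Sum>i<M. \<iota> (k i) * z i) = (\<Sum>i<M. k i * f y (z i))" for M :: nat and k z y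
    by (induction M) (simp_all add: f_add f_scale f_zero)
  define A where "A i j = f (e i) (e j)" for i j
  define a where "a g = (\<Sum>i<N. \<Sum>j<N. \<iota> (A i j) * (c i * g (c j)))" for g
  have A_skew: "A i j = - A j i" for i j unfolding A_def by (rule f_skew)
  \<comment> \<open>At the identity the summands are alternating in \<open>i\<close> and
    \<open>j\<close>, because \<open>A\<close> is and \<open>c i * c j\<close> is symmetric.\<close>
  have "a id = 0"
    unfolding a_def
  proof (rule sum_alternating_eq_zero)
    show "\<iota> (A i j) * (c i * id (c j)) = - (\<iota> (A j i) * (c j * id (c i)))" for i j
      using embed_diff[of 0 "A j i"] by (subst A_skew) (simp add: embed_zero mult_ac)
    show "\<iota> (A i i) * (c i * id (c i)) = 0" for i
      by (simp add: A_def f_diag embed_zero)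
  qed
  moreover have "a (inv\<^bsub>galois_group \<iota>\<^esub> g) = - (inv\<^bsub>galois_group \<iota>\<^esub> g) (a g)" if g: "g \<in> Gal" for g
  proof -
    let ?h = "inv\<^bsub>galois_group \<iota>\<^esub> g"
    have h: "?h \<in> Gal" using g by simp
    have "?h (a g) = (\<Sum>i<N. \<Sum>j<N. \<iota> (A i j) * (?h (c i) * c j))"
      by (simp add: a_def gal_sum[OF h] gal_times[OF h] gal_embed[OF h] gal_inv_left[OF g])
    also have "\<dots> = (\<Sum>j<N. \<Sum>i<N. \<iota> (A i j) * (?h (c i) * c j))"
      by (rule sum.swap)
    also have "\<dots> = (\<Sum>j<N. \<Sum>i<N. - (\<iota> (A j i) * (c j * ?h (c i))))"
    proof (intro sum.cong refl)
      fix i j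
      show "\<iota> (A i j) * (?h (c i) * c j) = - (\<iota> (A j i) * (c j * ?h (c i)))"
        using embed_diff[of 0 "A j i"] by (subst A_skew) (simp add: embed_zero mult_ac)
    qed
    also have "\<dots> = - a ?h" by (simp add: a_def sum_negf)
    finally show ?thesis by simp
  qed
  moreover have "f x y = (\<Sum>g\<in>Gal. tr (a g * x * g y))" for x y
  proof -
    have "\<iota> (f x y) = \<iota> (f (\<Sum>i<N. \<iota> (tr (c i * x)) * e i) (\<Sum>j<N. \<iota> (tr (c j * y)) * e j))"
      by (simp only: trace_expansion[OF ce, symmetric])
    also have "f (\<Sum>i<N. \<iota> (tr (c i * x)) * e i) (\<Sum>j<N. \<iota> (tr (c j * y)) * e j) =
        (\<Sum>i<N. \<Sum>j<N. tr (c i * x) * (tr (c j * y) * A i j))"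
      by (simp only: f_sum(1)) (simp add: f_sum(2) sum_distrib_left A_def)
    also have "\<iota> \<dots> = (\<Sum>i<N. \<Sum>j<N. \<iota> (A i j) * ((\<Sum>g\<in>Gal. g (c i) * g x) * (\<Sum>h\<in>Gal. h (c j) * h y)))"
      by (simp add: embed_sum embed_mult embed_gal_trace gal_times mult_ac)
    also have "\<dots> = (\<Sum>i<N. \<Sum>j<N. \<Sum>g\<in>Gal. \<Sum>h\<in>Gal. \<iota> (A i j) * (g (c i) * h (c j)) * (g x * h y))"
      unfolding sum_product by (simp add: sum_distrib_left mult_ac)
    \<comment> \<open>Replacing \<open>h\<close> by \<open>g \<circ> h\<close> makes the summand the
      value of \<open>g\<close> at an expression free of \<open>g\<close>. The steps after it
      interchange sums until those over \<open>i\<close> and \<open>j\<close> collect to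
      \<open>a h\<close>.\<close>
    also have "\<dots> = (\<Sum>i<N. \<Sum>j<N. \<Sum>g\<in>Gal. \<Sum>h\<in>Gal. \<iota> (A i j) * (g (c i) * g (h (c j))) * (g x * g (h y)))"
    proof (rule sum.cong[OF refl], rule sum.cong[OF refl], rule sum.cong[OF refl])
      fix i j g assume g: "g \<in> Gal"
      show "(\<Sum>h\<in>Gal. \<iota> (A i j) * (g (c i) * h (c j)) * (g x * h y)) =
          (\<Sum>h\<in>Gal. \<iota> (A i j) * (g (c i) * g (h (c j))) * (g x * g (h y)))"
        by (rule sum.reindex_bij_witness[where j = "\<lambda>h. inv\<^bsub>galois_group \<iota>\<^esub> g \<circ> h" and i = "\<lambda>h. g \<circ> h"])
          (auto simp: g gal_comp fun_eq_iff gal_inv_left gal_inv_right)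
    qed
    also have "\<dots> = (\<Sum>i<N. \<Sum>g\<in>Gal. \<Sum>j<N. \<Sum>h\<in>Gal. \<iota> (A i j) * (g (c i) * g (h (c j))) * (g x * g (h y)))"
      by (rule sum.cong[OF refl], rule sum.swap)
    also have "\<dots> = (\<Sum>g\<in>Gal. \<Sum>i<N. \<Sum>j<N. \<Sum>h\<in>Gal. \<iota> (A i j) * (g (c i) * g (h (c j))) * (g x * g (h y)))"
      by (rule sum.swap)
    also have "\<dots> = (\<Sum>g\<in>Gal. \<Sum>i<N. \<Sum>h\<in>Gal. \<Sum>j<N. \<iota> (A i j) * (g (c i) * g (h (c j))) * (g x * g (h y)))"
      by (rule sum.cong[OF refl], rule sum.cong[OF refl], rule sum.swap)
    also have "\<dots> = (\<Sum>g\<in>Gal. \<Sum>h\<in>Gal. \<Sum>i<N. \<Sum>j<N. \<iota> (A i j) * (g (c i) * g (h (c j))) * (g x * g (h y)))"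
      by (rule sum.cong[OF refl], rule sum.swap)
    also have "\<dots> = (\<Sum>g\<in>Gal. \<Sum>h\<in>Gal. g (a h * x * h y))"
      by (intro sum.cong refl)
        (simp add: a_def gal_sum gal_times gal_embed sum_distrib_right mult.assoc)
    also have "\<dots> = (\<Sum>h\<in>Gal. \<Sum>g\<in>Gal. g (a h * x * h y))"
      by (rule sum.swap)
    also have "\<dots> = \<iota> (\<Sum>h\<in>Gal. tr (a h * x * h y))"
      by (simp add: embed_sum embed_gal_trace)
    finally show ?thesis by (simp only: embed_inject)
  qed
  ultimately show ?thesis by (intro exI[of _ a]) simp
qed

text \<open>Any \<open>d\<close> moved by \<open>g\<close> works. The resulting
  \<open>w = d - g d\<close> serves as a divisor in place of \<open>2\<close>, which may be
  zero.\<close>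

lemma involution_factor:
  assumes g: "g \<in> Gal" and gg: "g \<circ> g = id" and ne: "g \<noteq> id"
  obtains d where "d - g d \<noteq> 0" "g (d - g d) = - (d - g d)"
proof -
  obtain d where "g d \<noteq> d" using ne by (auto simp: fun_eq_iff)
  moreover have "g (g d) = d" using fun_cong[OF gg, of d] by simp
  ultimately show thesis by (intro that[of d]) (simp_all add: gal_diff[OF g])
qed

lemma inv_eq_self_iff:
  assumes g: "g \<in> Gal"
  shows "inv\<^bsub>galois_group \<iota>\<^esub> g = g \<longleftrightarrow> g \<circ> g = id"
  using gal.r_inv[OF g] gal.inv_equality[of g g] g by (auto simp: gal_mult_eq gal_one_eq)

text \<open>Additive Hilbert 90 for an involution \<open>g\<close>, valid in every characteristic: \<open>c = b - g b\<close> is solved by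
  \<open>b = d c / w\<close>, where \<open>w = d - g d \<noteq> 0\<close>.\<close>

lemma galois_form_of_pair:
  assumes g: "g \<in> Gal" and ne: "g \<noteq> id"
    and a: "a (inv\<^bsub>galois_group \<iota>\<^esub> g) = - (inv\<^bsub>galois_group \<iota>\<^esub> g) (a g)"
  shows "\<exists>b. \<forall>x y. galois_form \<iota> b g x y =
    (\<Sum>h\<in>{g, inv\<^bsub>galois_group \<iota>\<^esub> g}. tr (a h * x * h y))"
proof -
  let ?h = "inv\<^bsub>galois_group \<iota>\<^esub> g"
  have h: "?h \<in> Gal" using g by simp
  show ?thesis
  proof (cases "?h = g")
    case False
    \<comment> \<open>When \<open>g\<close> differs from its inverse, \<open>b = a g\<close> works:
      the skewness of \<open>a\<close> identifies the second trace in
      \<open>galois_form_swap\<close> with the summand of the inverse.\<close>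
    have "tr (- (?h (a g)) * x * ?h y) = - tr (?h (a g) * x * ?h y)" for x y
      using trace_diff[of 0 "?h (a g) * x * ?h y"] by (simp add: trace_zero)
    then show ?thesis
      using False by (intro exI[of _ "a g"]) (auto simp: galois_form_swap[OF g] a)
  next
    case True
    then have gg: "g \<circ> g = id" using inv_eq_self_iff[OF g] by simp
    obtain d where d: "d - g d \<noteq> 0" "g (d - g d) = - (d - g d)"
      using involution_factor[OF g gg ne] .
    define w where "w = d - g d"
    define b where "b = d * a g / w"
    have ag: "g (a g) = - a g" using a True by (metis minus_minus)
    have w: "w \<noteq> 0" "g w = - w" using d by (simp_all add: w_def)
    have "b - g b = d * a g / w - g d * a g / w"
      by (simp add: b_def gal_divide[OF g] gal_times[OF g] ag w(2))
    also have "\<dots> = w * a g / w" by (simp add: w_def diff_divide_distrib left_diff_distrib)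
    finally have "b - g b = a g" using w(1) by simp
    then have "galois_form \<iota> b g x y = tr (a g * x * g y)" for x y
      using True by (simp add: galois_form_swap[OF g] flip: trace_diff left_diff_distrib)
    then show ?thesis using True by auto
  qed
qed

text \<open>Nondegeneracy of the trace turns the relation into one between the automorphisms
  \<open>T i\<close> and their inverses, and a family separating \<open>T k\<close> isolates
  \<open>d k\<close>. If \<open>T k\<close> is its own inverse, only \<open>d k - T k (d k)\<close>
  is isolated; so the conclusion is that the form vanishes, not \<open>d k\<close>.\<close>

lemma galois_forms_independent:
  assumes fin: "finite I" and T: "\<And>i. i \<in> I \<Longrightarrow> T i \<in> Gal"
    and inj: "\<And>i j. i \<in> I \<Longrightarrow> j \<in> I \<Longrightarrow> T i = T j \<Longrightarrow> i = j"
    and inj': "\<And>i j. i \<in> I \<Longrightarrow> j \<in> I \<Longrightarrow> T i = inv\<^bsub>galois_group \<iota>\<^esub> (T j) \<Longrightarrow> i = j"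
    and sum: "(\<Sum>i\<in>I. galois_form \<iota> (d i) (T i)) = 0" and k: "k \<in> I"
  shows "galois_form \<iota> (d k) (T k) = 0"
proof -
  let ?i = "\<lambda>g. inv\<^bsub>galois_group \<iota>\<^esub> g"
  have iT: "?i (T i) \<in> Gal" if "i \<in> I" for i using T[OF that] by simp
  have zero: "(\<Sum>i\<in>I. d i * T i y - ?i (T i) (d i) * ?i (T i) y) = 0" for y
  proof (rule trace_nondegenerate)
    fix x
    have tr_sum: "tr (\<Sum>i\<in>I. F i) = (\<Sum>i\<in>I. tr (F i))" for F
      by (induction I rule: infinite_finite_induct) (simp_all add: trace_zero trace_add)
    have "tr ((\<Sum>i\<in>I. d i * T i y - ?i (T i) (d i) * ?i (T i) y) * x) =
        (\<Sum>i\<in>I. galois_form \<iota> (d i) (T i) x y)"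
      unfolding sum_distrib_right tr_sum
      by (intro sum.cong refl)
        (simp add: galois_form_swap[OF T] trace_diff left_diff_distrib right_diff_distrib mult_ac)
    also have "\<dots> = 0"
      using sum_form_apply[of "\<lambda>i. galois_form \<iota> (d i) (T i)" I x y] sum by simp
    finally show "tr ((\<Sum>i\<in>I. d i * T i y - ?i (T i) (d i) * ?i (T i) y) * x) = 0" .
  qed
  obtain c e and N :: nat where
    ce: "\<forall>g\<in>Gal. (\<Sum>i<N. c i * g (e i)) = (if g = T k then 1 else 0)"
    using separating_family[OF finite_gal order_refl T[OF k]] by blast
  have "0 = (\<Sum>l<N. c l * (\<Sum>i\<in>I. d i * T i (e l) - ?i (T i) (d i) * ?i (T i) (e l)))"
    by (simp add: zero)
  also have "\<dots> = (\<Sum>l<N. \<Sum>i\<in>I. d i * (c l * T i (e l)) - ?i (T i) (d i) * (c l * ?i (T i) (e l)))"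
    by (simp add: sum_distrib_left algebra_simps)
  also have "\<dots> = (\<Sum>i\<in>I. \<Sum>l<N. d i * (c l * T i (e l)) - ?i (T i) (d i) * (c l * ?i (T i) (e l)))"
    by (rule sum.swap)
  also have "\<dots> = (\<Sum>i\<in>I. d i * (\<Sum>l<N. c l * T i (e l)) - ?i (T i) (d i) * (\<Sum>l<N. c l * ?i (T i) (e l)))"
    by (simp add: sum_subtractf sum_distrib_left)
  also have "\<dots> = (\<Sum>i\<in>I. if i = k then d k - (if ?i (T k) = T k then ?i (T k) (d k) else 0) else 0)"
  proof (intro sum.cong refl)
    fix i assume i: "i \<in> I"
    have 1: "T i = T k \<longleftrightarrow> i = k" using inj i k by blast
    have 2: "?i (T i) = T k \<Longrightarrow> i = k" using inj'[OF k i] by simp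
    have "(\<Sum>l<N. c l * T i (e l)) = (if i = k then 1 else 0)"
      using bspec[OF ce T[OF i]] 1 by simp
    moreover have "(\<Sum>l<N. c l * ?i (T i) (e l)) = (if ?i (T i) = T k then 1 else 0)"
      using bspec[OF ce iT[OF i]] .
    ultimately show "d i * (\<Sum>l<N. c l * T i (e l)) - ?i (T i) (d i) * (\<Sum>l<N. c l * ?i (T i) (e l)) =
        (if i = k then d k - (if ?i (T k) = T k then ?i (T k) (d k) else 0) else 0)"
      using 2 by auto
  qed
  also have "\<dots> = d k - (if ?i (T k) = T k then ?i (T k) (d k) else 0)"
    using fin k by simp
  finally have dk: "d k = (if ?i (T k) = T k then ?i (T k) (d k) else 0)" by simp
  show ?thesis
  proof (cases "?i (T k) = T k")
    case True
    then have "T k (d k) = d k" using dk by simp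
    then show ?thesis using True
      by (simp add: fun_eq_iff galois_form_swap[OF T[OF k]])
  next
    case False
    then have "d k = 0" using dk by simp
    then show ?thesis by (simp add: galois_form_def fun_eq_iff trace_zero)
  qed
qed

text \<open>Uniqueness is the independence of the forms, applied to the difference of two families.
  For existence the trace expansion of \<open>f\<close> is grouped into pairs of inverse
  automorphisms, each contributing one Galois form.\<close>

lemma internal_direct_sum_galois_forms:
  assumes fin: "finite I" and T: "\<And>i. i \<in> I \<Longrightarrow> T i \<in> Gal" and ne: "\<And>i. i \<in> I \<Longrightarrow> T i \<noteq> id"
    and inj: "\<And>i j. i \<in> I \<Longrightarrow> j \<in> I \<Longrightarrow> T i = T j \<Longrightarrow> i = j"
    and inj': "\<And>i j. i \<in> I \<Longrightarrow> j \<in> I \<Longrightarrow> T i = inv\<^bsub>galois_group \<iota>\<^esub> (T j) \<Longrightarrow> i = j"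
    and cover: "\<And>g. g \<in> Gal \<Longrightarrow> g \<noteq> id \<Longrightarrow> \<exists>i\<in>I. g = T i \<or> g = inv\<^bsub>galois_group \<iota>\<^esub> (T i)"
  shows "internal_direct_sum form_scale (Alt \<iota>) I (\<lambda>i. range (\<lambda>b. galois_form \<iota> b (T i)))"
proof -
  let ?i = "\<lambda>g. inv\<^bsub>galois_group \<iota>\<^esub> g"
  let ?V = "\<lambda>i. range (\<lambda>b. galois_form \<iota> b (T i))"
  interpret F: vector_space form_scale by (rule vector_space_form_scale)
  have "inj_on (\<lambda>v. \<Sum>i\<in>I. v i) (\<Pi>\<^sub>E i\<in>I. ?V i)"
  proof (rule inj_onI)
    fix v v' assume v: "v \<in> (\<Pi>\<^sub>E i\<in>I. ?V i)" "v' \<in> (\<Pi>\<^sub>E i\<in>I. ?V i)"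
      and eq: "(\<Sum>i\<in>I. v i) = (\<Sum>i\<in>I. v' i)"
    have "\<forall>i\<in>I. \<exists>d. v i - v' i = galois_form \<iota> d (T i)"
    proof
      fix i assume "i \<in> I"
      then obtain b b' where "v i = galois_form \<iota> b (T i)" "v' i = galois_form \<iota> b' (T i)"
        using v by (meson PiE_mem imageE)
      then show "\<exists>d. v i - v' i = galois_form \<iota> d (T i)"
        by (auto simp flip: galois_form_diff)
    qed
    then obtain d where d: "\<forall>i\<in>I. v i - v' i = galois_form \<iota> (d i) (T i)"
      by (rule bchoice[THEN exE])
    have "(\<Sum>i\<in>I. galois_form \<iota> (d i) (T i)) = (\<Sum>i\<in>I. v i - v' i)"
      using d by (intro sum.cong) auto
    also have "\<dots> = 0" using eq by (simp add: sum_subtractf)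
    finally have sum0: "(\<Sum>i\<in>I. galois_form \<iota> (d i) (T i)) = 0" .
    have "galois_form \<iota> (d i) (T i) = 0" if i: "i \<in> I" for i
      by (rule galois_forms_independent[OF fin _ _ _ sum0 i]) (rule T inj inj'; assumption)+
    then have "v i = v' i" if "i \<in> I" for i using d that by simp
    then show "v = v'" by (rule PiE_ext[OF v])
  qed
  moreover have "(\<lambda>v. \<Sum>i\<in>I. v i) ` (\<Pi>\<^sub>E i\<in>I. ?V i) = Alt \<iota>"
  proof (intro equalityI subsetI)
    fix f assume "f \<in> (\<lambda>v. \<Sum>i\<in>I. v i) ` (\<Pi>\<^sub>E i\<in>I. ?V i)"
    then obtain v where v: "v \<in> (\<Pi>\<^sub>E i\<in>I. ?V i)" "f = (\<Sum>i\<in>I. v i)" by auto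
    have "v i \<in> Alt \<iota>" if "i \<in> I" for i
      using PiE_mem[OF v(1) that] galois_form_Alt[OF T[OF that]] by auto
    then show "f \<in> Alt \<iota>" unfolding v(2) by (intro F.subspace_sum Alt_subspace)
  next
    fix f assume "f \<in> Alt \<iota>"
    then obtain a where a: "a id = 0" "\<forall>g\<in>Gal. a (?i g) = - ?i g (a g)"
      and f: "\<forall>x y. f x y = (\<Sum>g\<in>Gal. tr (a g * x * g y))"
      using Alt_expansion by blast
    have "\<forall>i\<in>I. \<exists>b. \<forall>x y. galois_form \<iota> b (T i) x y = (\<Sum>h\<in>{T i, ?i (T i)}. tr (a h * x * h y))"
      using galois_form_of_pair[OF T ne] a(2) T by blast
    then obtain b where b: "\<forall>i\<in>I. \<forall>x y. galois_form \<iota> (b i) (T i) x y =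
        (\<Sum>h\<in>{T i, ?i (T i)}. tr (a h * x * h y))"
      by (rule bchoice[THEN exE])
    define v where "v = (\<lambda>i\<in>I. galois_form \<iota> (b i) (T i))"
    \<comment> \<open>The sets \<open>{T i, ?i (T i)}\<close> partition the non-identity elements;
      for an involution the set is a singleton, so its term is counted once.\<close>
    have union: "(\<Union>i\<in>I. {T i, ?i (T i)}) = Gal - {id}"
    proof (intro equalityI subsetI)
      fix g assume "g \<in> (\<Union>i\<in>I. {T i, ?i (T i)})"
      then obtain i where i: "i \<in> I" "g = T i \<or> g = ?i (T i)" by blast
      moreover have "?i (T i) \<noteq> id"
        using gal.inv_eq_1_iff[OF T[OF i(1)], unfolded gal_one_eq] ne[OF i(1)] by blast
      ultimately show "g \<in> Gal - {id}" using T[OF i(1)] ne[OF i(1)] by auto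
    qed (use cover in auto)
    have "f x y = (\<Sum>i\<in>I. v i) x y" for x y
    proof -
      have "f x y = (\<Sum>g\<in>Gal - {id}. tr (a g * x * g y))"
        using f a(1) finite_gal by (simp add: sum.remove[OF finite_gal gal_id] trace_zero)
      also have "\<dots> = (\<Sum>i\<in>I. \<Sum>h\<in>{T i, ?i (T i)}. tr (a h * x * h y))"
        unfolding union[symmetric]
      proof (rule sum.UNION_disjoint[OF fin])
        show "\<forall>i\<in>I. \<forall>j\<in>I. i \<noteq> j \<longrightarrow> {T i, ?i (T i)} \<inter> {T j, ?i (T j)} = {}"
        proof (intro ballI impI)
          fix i j assume ij: "i \<in> I" "j \<in> I" "i \<noteq> j"
          have "T i \<noteq> T j" "T i \<noteq> ?i (T j)" "T j \<noteq> ?i (T i)"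
            using inj inj' ij by blast+
          moreover have "?i (T i) \<noteq> ?i (T j)"
            using \<open>T i \<noteq> T j\<close> T ij by (metis gal.inv_inv)
          ultimately show "{T i, ?i (T i)} \<inter> {T j, ?i (T j)} = {}" by auto
        qed
      qed simp
      also have "\<dots> = (\<Sum>i\<in>I. v i x y)"
        using b by (intro sum.cong) (auto simp: v_def)
      finally show ?thesis by (simp only: sum_form_apply)
    qed
    then have "f = (\<Sum>i\<in>I. v i)" by (simp add: fun_eq_iff)
    moreover have "v \<in> (\<Pi>\<^sub>E i\<in>I. ?V i)" by (auto simp: v_def)
    ultimately show "f \<in> (\<lambda>v. \<Sum>i\<in>I. v i) ` (\<Pi>\<^sub>E i\<in>I. ?V i)" by (rule image_eqI)
  qed
  ultimately show ?thesis
    unfolding internal_direct_sum_def bij_betw_def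
    using fin Alt_subspace galois_forms_subspace by blast
qed

section \<open>Dimensions of the summands\<close>

lemma dim_galois_forms:
  assumes g: "g \<in> Gal" and gg: "g \<circ> g \<noteq> id"
  shows "vector_space.dim form_scale (range (\<lambda>b. galois_form \<iota> b g)) = ext_degree \<iota>"
proof -
  have "inj (\<lambda>b. galois_form \<iota> b g)"
  proof (rule injI)
    fix b c assume "galois_form \<iota> b g = galois_form \<iota> c g"
    then have "galois_form \<iota> (b - c) g = 0" by (simp add: galois_form_diff)
    then show "b = c" using galois_form_nonzero[OF g gg, of "b - c"] by auto
  qed
  then show ?thesis
    unfolding ext_degree_def
    by (intro dim_linear_image ext.vector_space_axioms vector_space_form_scale ext.subspace_UNIV)
      (simp_all add: galois_form_add galois_form_scale)
qed

text \<open>Both traces in \<open>galois_form_swap\<close> involve the same automorphism, so the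
  form depends on \<open>b\<close> only through \<open>b - g b\<close>.\<close>

lemma galois_form_involution:
  assumes g: "g \<in> Gal" and gg: "g \<circ> g = id"
  shows "galois_form \<iota> b g x y = tr ((b - g b) * x * g y)"
proof -
  have "inv\<^bsub>galois_group \<iota>\<^esub> g = g" using inv_eq_self_iff[OF g] gg by simp
  then show ?thesis by (simp add: galois_form_swap[OF g] trace_diff left_diff_distrib)
qed

lemma galois_form_involution_eq_iff:
  assumes g: "g \<in> Gal" and gg: "g \<circ> g = id"
  shows "galois_form \<iota> b g = 0 \<longleftrightarrow> g b = b"
proof
  assume "galois_form \<iota> b g = 0"
  then have "b * 1 = g b * g (g 1)"
    unfolding galois_form_eq_zero_iff[OF g] by blast
  then show "g b = b" by (simp add: gal_unit[OF g])
next
  assume "g b = b"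
  then show "galois_form \<iota> b g = 0"
    by (simp add: fun_eq_iff galois_form_involution[OF g gg] trace_zero)
qed

text \<open>If \<open>w = d - g d \<noteq> 0\<close>, the elements \<open>b - g b\<close> are exactly the \<open>w e\<close> with \<open>g e = e\<close>, so the forms are
  already parametrized by \<open>b = d e\<close>.\<close>

lemma dim_galois_forms_involution:
  assumes g: "g \<in> Gal" and gg: "g \<circ> g = id" and ne: "g \<noteq> id"
  shows "vector_space.dim form_scale (range (\<lambda>b. galois_form \<iota> b g)) = ext.dim {x. g x = x}"
proof -
  obtain d where d: "d - g d \<noteq> 0" "g (d - g d) = - (d - g d)"
    using involution_factor[OF g gg ne] .
  define w where "w = d - g d"
  have w: "w \<noteq> 0" "g w = - w" using d by (simp_all add: w_def)
  have ggx: "g (g x) = x" for x using fun_cong[OF gg, of x] by simp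
  let ?E = "{x. g x = x}"
  let ?f = "\<lambda>e. galois_form \<iota> (d * e) g"
  have we: "d * e - g (d * e) = w * e" if "g e = e" for e
    using that by (simp add: w_def gal_times[OF g] left_diff_distrib)
  have "range (\<lambda>b. galois_form \<iota> b g) = ?f ` ?E"
  proof (intro equalityI subsetI)
    fix f assume "f \<in> range (\<lambda>b. galois_form \<iota> b g)"
    then obtain b where b: "f = galois_form \<iota> b g" by blast
    \<comment> \<open>Both \<open>b - g b\<close> and \<open>w\<close> are negated by
      \<open>g\<close>, hence their quotient is fixed.\<close>
    define e where "e = (b - g b) / w"
    have "g e = (g b - b) / (- w)"
      by (simp only: e_def gal_divide[OF g] gal_diff[OF g] ggx w(2))
    also have "\<dots> = e"
      unfolding e_def using minus_divide_divide[of "b - g b" w] by simp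
    finally have e: "g e = e" .
    have "d * e - g (d * e) = b - g b"
      using w(1) by (simp only: we[OF e]) (simp add: e_def)
    then have "f = ?f e"
      by (simp add: b fun_eq_iff galois_form_involution[OF g gg])
    with e show "f \<in> ?f ` ?E" by blast
  qed auto
  moreover have "inj_on ?f ?E"
  proof (rule inj_onI)
    fix e e' assume e: "e \<in> ?E" "e' \<in> ?E" and "?f e = ?f e'"
    then have "galois_form \<iota> (d * e - d * e') g = 0" by (simp add: galois_form_diff)
    then have "g (d * e - d * e') = d * e - d * e'"
      by (simp only: galois_form_involution_eq_iff[OF g gg])
    then have "d * e - g (d * e) = d * e' - g (d * e')"
      by (simp add: gal_diff[OF g] algebra_simps)
    moreover have "g e = e" "g e' = e'" using e by simp_all
    ultimately have "w * e = w * e'"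
      by (simp only: we)
    then show "e = e'" using w(1) by simp
  qed
  moreover have "?f (ext_scale \<iota> c x) = form_scale c (?f x)" for c x
    by (simp add: ext_scale_def mult.left_commute flip: galois_form_scale)
  moreover have "?f (x + y) = ?f x + ?f y" for x y
    by (simp add: distrib_left galois_form_add)
  ultimately show ?thesis
    using dim_linear_image[OF ext.vector_space_axioms vector_space_form_scale subspace_fixed[OF g], of ?f]
    by simp
qed

text \<open>For an involution the radical condition reads \<open>b * x = g b * x\<close>, and
  \<open>g b \<noteq> b\<close> when the form is non-zero.\<close>

lemma radical_involution:
  assumes g: "g \<in> Gal" and gg: "g \<circ> g = id" and nz: "galois_form \<iota> b g \<noteq> 0"
  shows "form_radical (galois_form \<iota> b g) = {0}"
proof -
  have "g (g x) = x" for x using fun_cong[OF gg, of x] by simp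
  then show ?thesis
    using nz by (auto simp: mem_radical_galois_form_iff[OF g] galois_form_involution_eq_iff[OF g gg])
qed

section \<open>Orders of automorphisms and ranks of forms\<close>

lemma gal_ord_eq_2_iff:
  assumes g: "g \<in> Gal"
  shows "gal.ord g = 2 \<longleftrightarrow> g \<circ> g = id \<and> g \<noteq> id"
proof -
  have "g \<circ> g = id \<longleftrightarrow> gal.ord g dvd 2"
    using funpow_eq_id_iff[OF g, of 2] by (simp add: numeral_2_eq_2)
  also have "\<dots> \<longleftrightarrow> gal.ord g = 1 \<or> gal.ord g = 2"
    using prime_nat_iff[of 2] two_is_prime_nat by auto
  also have "gal.ord g = 1 \<longleftrightarrow> g = id"
    using gal.ord_eq_1[OF g] by (simp only: gal_one_eq)
  finally have "g \<circ> g = id \<longleftrightarrow> g = id \<or> gal.ord g = 2" .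
  moreover have "gal.ord id = 1"
    using gal.ord_id by (simp only: gal_one_eq)
  ultimately show ?thesis by fastforce
qed

lemma form_rank_if_radical_nonzero:
  assumes g: "g \<in> Gal" and b: "b \<noteq> 0"
    and x: "x \<in> form_radical (galois_form \<iota> b g)" "x \<noteq> 0"
  shows "real (form_rank \<iota> (galois_form \<iota> b g)) =
    real (ext_degree \<iota>) - real (ext_degree \<iota>) / real (gal.ord (g \<circ> g))"
proof -
  define D where "D = ext.dim {z. g (g z) = z}"
  have gg: "g \<circ> g \<in> Gal" using gal_comp[OF g g] .
  have o: "gal.ord (g \<circ> g) \<ge> 1" using gal.ord_ge_1[OF finite_gal gg] .
  have D: "D * gal.ord (g \<circ> g) = ext_degree \<iota>"
    using dim_fixed_by[OF gg] by (simp add: D_def)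
  \<comment> \<open>This bound makes the natural-number subtraction in \<open>form_rank\<close>
    agree with the real one.\<close>
  then have "D \<le> ext_degree \<iota>"
    using o by (metis mult.right_neutral mult_le_mono2)
  moreover have "real D = real (ext_degree \<iota>) / real (gal.ord (g \<circ> g))"
    using o by (simp flip: D)
  ultimately show ?thesis
    using dim_radical[OF g b x] by (simp add: form_rank_def D_def)
qed

text \<open>For odd order every such form has a non-zero radical, and \<open>g \<circ> g\<close> has
  the same order as \<open>g\<close>.\<close>

lemma form_rank_galois_form_odd:
  assumes g: "g \<in> Gal" and ord: "gal.ord g = 2 * r + 1" and nz: "galois_form \<iota> b g \<noteq> 0"
  shows "real (form_rank \<iota> (galois_form \<iota> b g)) =
    real (ext_degree \<iota>) - real (ext_degree \<iota>) / real (2 * r + 1)"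
proof -
  have b: "b \<noteq> 0" using nz galois_form_diff[of 0 0 g] by auto
  have "gcd (2 * r + 1) 2 = 1"
    using coprime_iff_gcd_eq_1[of "2 * r + 1" "2::nat"] by simp
  then have "gal.ord (g \<circ> g) = 2 * r + 1"
    by (simp only: ord_comp_self[OF g] ord) simp
  then show ?thesis
    using radical_nonzero_if_odd[OF g ord b] form_rank_if_radical_nonzero[OF g b] by metis
qed

lemma ord_comp_self_even:
  assumes g: "g \<in> Gal" and ord: "gal.ord g = 2 * r"
  shows "gal.ord (g \<circ> g) = r"
  by (simp add: ord_comp_self[OF g] ord)

lemma form_rank_galois_form_even:
  assumes g: "g \<in> Gal" and ord: "gal.ord g = 2 * r" and nz: "galois_form \<iota> b g \<noteq> 0"
  shows "form_rank \<iota> (galois_form \<iota> b g) = ext_degree \<iota> \<or>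
    real (form_rank \<iota> (galois_form \<iota> b g)) = real (ext_degree \<iota>) - real (ext_degree \<iota>) / real r"
proof (cases "form_radical (galois_form \<iota> b g) = {0}")
  case False
  have b: "b \<noteq> 0" using nz galois_form_diff[of 0 0 g] by auto
  obtain x where "x \<in> form_radical (galois_form \<iota> b g)" "x \<noteq> 0"
    using False zero_mem_radical[OF g, of b] by blast
  then show ?thesis
    using form_rank_if_radical_nonzero[OF g b] ord_comp_self_even[OF g ord] by metis
qed (simp add: form_rank_full)

text \<open>For \<open>b = 1\<close> the element \<open>1\<close> lies in the radical, which is
  therefore non-zero.\<close>

lemma form_rank_galois_form_one:
  assumes g: "g \<in> Gal" and ord: "gal.ord g = 2 * r"
  shows "real (form_rank \<iota> (galois_form \<iota> 1 g)) = real (ext_degree \<iota>) - real (ext_degree \<iota>) / real r"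
proof -
  have "1 \<in> form_radical (galois_form \<iota> 1 g)"
    by (simp add: mem_radical_galois_form_iff[OF g] gal_unit[OF g])
  then show ?thesis
    using form_rank_if_radical_nonzero[OF g, of 1 1] ord_comp_self_even[OF g ord] by simp
qed

end

theorem corollary4:
  fixes \<iota> :: "'k::field \<Rightarrow> 'l::field"
    and n k m :: nat
    and \<tau> \<sigma> :: "nat \<Rightarrow> 'l \<Rightarrow> 'l"
    and A B :: "nat \<Rightarrow> ('l \<Rightarrow> 'l \<Rightarrow> 'k) set"
  defines "G \<equiv> galois_group \<iota>"
  assumes galois: "finite_galois_extension \<iota>"
    and degree: "ext_degree \<iota> = n"
    and even_degree: "even n"
    and involutions: "bij_betw \<tau> {1..k} {g \<in> carrier G. group.ord G g = 2}"
    and others_inj: "inj_on \<sigma> {1..m}"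
    and others_disjoint: "\<sigma> ` {1..m} \<inter> (\<lambda>j. inv\<^bsub>G\<^esub> (\<sigma> j)) ` {1..m} = {}"
    and others_all: "\<sigma> ` {1..m} \<union> (\<lambda>j. inv\<^bsub>G\<^esub> (\<sigma> j)) ` {1..m}
        = {g \<in> carrier G. g \<noteq> \<one>\<^bsub>G\<^esub> \<and> group.ord G g \<noteq> 2}"
  defines "B \<equiv> (\<lambda>i. range (\<lambda>b. galois_form \<iota> b (\<tau> i)))"
    and "A \<equiv> (\<lambda>j. range (\<lambda>b. galois_form \<iota> b (\<sigma> j)))"
  shows "1 + k + 2 * m = n
    \<and> internal_direct_sum form_scale (Alt \<iota>) ({1..k} <+> {1..m}) (case_sum B A)
    \<and> (\<forall>i\<in>{1..k}. real (vector_space.dim form_scale (B i)) = real n / 2)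
    \<and> (\<forall>j\<in>{1..m}. vector_space.dim form_scale (A j) = n)
    \<and> (\<forall>i\<in>{1..k}. \<forall>f\<in>B i. f \<noteq> 0 \<longrightarrow> form_rank \<iota> f = n)
    \<and> (\<forall>j\<in>{1..m}. \<forall>r. group.ord G (\<sigma> j) = 2 * r + 1 \<longrightarrow>
          (\<forall>f\<in>A j. f \<noteq> 0 \<longrightarrow> real (form_rank \<iota> f) = real n - real n / real (2 * r + 1)))
    \<and> (\<forall>j\<in>{1..m}. \<forall>r. group.ord G (\<sigma> j) = 2 * r \<and> 2 * r > 2 \<longrightarrow>
          (\<forall>f\<in>A j. f \<noteq> 0 \<longrightarrow>
             form_rank \<iota> f = n \<or> real (form_rank \<iota> f) = real n - real n / real r)
        \<and> (\<exists>f\<in>A j. f \<noteq> 0 \<and> form_rank \<iota> f = n)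
        \<and> (\<exists>f\<in>A j. f \<noteq> 0 \<and> real (form_rank \<iota> f) = real n - real n / real r))"
proof -
  interpret L: finite_galois_extension \<iota> by (rule galois)
  let ?i = "\<lambda>g. inv\<^bsub>galois_group \<iota>\<^esub> g"
  let ?S = "\<sigma> ` {1..m}" and ?S' = "(\<lambda>j. ?i (\<sigma> j)) ` {1..m}"
  let ?T = "{g \<in> L.Gal. L.gal.ord g = 2}"
  have bij: "bij_betw \<tau> {1..k} ?T"
    using involutions by (simp only: G_def)
  have disj: "?S \<inter> ?S' = {}"
    using others_disjoint by (simp only: G_def)
  have all: "?S \<union> ?S' = {g \<in> L.Gal. g \<noteq> id \<and> L.gal.ord g \<noteq> 2}"
    using others_all by (simp only: G_def L.gal_one_eq)
  have \<tau>: "\<tau> i \<in> L.Gal" "L.gal.ord (\<tau> i) = 2" if "i \<in> {1..k}" for i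
    using bij_betwE[OF bij] that by auto
  have \<tau>': "\<tau> i \<circ> \<tau> i = id" "\<tau> i \<noteq> id" if "i \<in> {1..k}" for i
    using L.gal_ord_eq_2_iff[OF \<tau>(1)[OF that]] \<tau>(2)[OF that] by auto
  have \<sigma>: "\<sigma> j \<in> L.Gal" "\<sigma> j \<noteq> id" "L.gal.ord (\<sigma> j) \<noteq> 2" if "j \<in> {1..m}" for j
  proof -
    have "\<sigma> j \<in> ?S \<union> ?S'" using that by blast
    then show "\<sigma> j \<in> L.Gal" "\<sigma> j \<noteq> id" "L.gal.ord (\<sigma> j) \<noteq> 2"
      unfolding all by simp_all
  qed
  have \<sigma>': "\<sigma> j \<circ> \<sigma> j \<noteq> id" if "j \<in> {1..m}" for j
    using L.gal_ord_eq_2_iff[OF \<sigma>(1)[OF that]] \<sigma>(2,3)[OF that] by auto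

  have "card ?S' = m"
  proof -
    have "inj_on (\<lambda>j. ?i (\<sigma> j)) {1..m}"
    proof (rule inj_onI)
      fix i j assume ij: "i \<in> {1..m}" "j \<in> {1..m}" and "?i (\<sigma> i) = ?i (\<sigma> j)"
      then have "\<sigma> i = \<sigma> j" using \<sigma>(1) by (metis L.gal.inv_inv)
      then show "i = j" using inj_onD[OF others_inj _ ij] by simp
    qed
    then show ?thesis by (simp add: card_image)
  qed
  moreover have "card ?S = m" using others_inj by (simp add: card_image)
  ultimately have others: "card (?S \<union> ?S') = 2 * m"
    using disj by (subst card_Un_disjoint) auto
  have fin: "finite ?T" "finite (?S \<union> ?S')"
    using L.finite_gal by auto
  have id: "id \<notin> ?T \<union> (?S \<union> ?S')" and disj': "?T \<inter> (?S \<union> ?S') = {}"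
    unfolding all using L.gal_ord_eq_2_iff[OF L.gal_id] by auto
  \<comment> \<open>The group consists of the identity, the elements of order 2, and the \<sigma>
    with their inverses; this yields the count \<open>1 + k + 2 * m\<close>.\<close>
  have "L.Gal = insert id (?T \<union> (?S \<union> ?S'))"
    unfolding all using L.gal_id by auto
  then have "card L.Gal = card (insert id (?T \<union> (?S \<union> ?S')))"
    by (rule arg_cong)
  also have "\<dots> = Suc (card (?T \<union> (?S \<union> ?S')))"
    by (rule card_insert_disjoint[OF finite_UnI[OF fin] id])
  also have "card (?T \<union> (?S \<union> ?S')) = card ?T + card (?S \<union> ?S')"
    using fin disj' by (rule card_Un_disjoint)
  finally have "card L.Gal = Suc (k + 2 * m)"
    using others bij_betw_same_card[OF bij] by simp
  then have count: "1 + k + 2 * m = n"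
    using L.ext_degree_eq_card_gal degree by simp

  \<comment> \<open>The two families of automorphisms are glued into one, indexed by the disjoint
    sum of their index sets.\<close>
  have "internal_direct_sum form_scale (Alt \<iota>) ({1..k} <+> {1..m})
    (\<lambda>i. range (\<lambda>b. galois_form \<iota> b (case_sum \<tau> \<sigma> i)))"
  proof (rule L.internal_direct_sum_galois_forms)
    fix p assume p: "p \<in> {1..k} <+> {1..m}"
    then show "case_sum \<tau> \<sigma> p \<in> L.Gal" "case_sum \<tau> \<sigma> p \<noteq> id"
      using \<tau>(1) \<tau>'(2) \<sigma>(1,2) by auto
    fix q assume q: "q \<in> {1..k} <+> {1..m}"
    have inj\<tau>: "i = j" if "i \<in> {1..k}" "j \<in> {1..k}" "\<tau> i = \<tau> j" for i j
      using bij_betw_imp_inj_on[OF bij] that by (auto dest: inj_onD)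
    \<comment> \<open>Elements of order 2 are their own inverses and inversion preserves orders;
      this rules out coincidences between a \<tau> and a \<sigma> or its inverse.\<close>
    have inv\<tau>: "?i (\<tau> i) = \<tau> i" if "i \<in> {1..k}" for i
      using L.inv_eq_self_iff[OF \<tau>(1)[OF that]] \<tau>'(1)[OF that] by simp
    have ord_inv: "L.gal.ord (?i (\<sigma> j)) \<noteq> 2" if "j \<in> {1..m}" for j
      using \<sigma>(1,3)[OF that] by simp
    have cross: "\<sigma> i \<noteq> ?i (\<sigma> j)" if "i \<in> {1..m}" "j \<in> {1..m}" for i j
      using disj that by blast
    show "p = q" if eq: "case_sum \<tau> \<sigma> p = case_sum \<tau> \<sigma> q"
    proof (cases p; cases q)
      fix i j assume pq: "p = Inl i" "q = Inl j"
      then show ?thesis using p q eq inj\<tau> by auto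
    next
      fix i j assume pq: "p = Inl i" "q = Inr j"
      then show ?thesis using p q eq \<tau>(2)[of i] \<sigma>(3)[of j] by auto
    next
      fix i j assume pq: "p = Inr i" "q = Inl j"
      then show ?thesis using p q eq \<tau>(2)[of j] \<sigma>(3)[of i] by auto
    next
      fix i j assume pq: "p = Inr i" "q = Inr j"
      then show ?thesis using p q eq inj_onD[OF others_inj, of i j] by auto
    qed
    show "p = q" if eq: "case_sum \<tau> \<sigma> p = ?i (case_sum \<tau> \<sigma> q)"
    proof (cases p; cases q)
      fix i j assume pq: "p = Inl i" "q = Inl j"
      then show ?thesis using p q eq inj\<tau>[of i j] inv\<tau>[of j] by auto
    next
      fix i j assume pq: "p = Inl i" "q = Inr j"
      then show ?thesis using p q eq \<tau>(2)[of i] ord_inv[of j] by auto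
    next
      fix i j assume pq: "p = Inr i" "q = Inl j"
      then show ?thesis using p q eq inv\<tau>[of j] \<tau>(2)[of j] \<sigma>(3)[of i] by auto
    next
      fix i j assume pq: "p = Inr i" "q = Inr j"
      then show ?thesis using p q eq cross[of i j] by auto
    qed
  next
    fix g assume g: "g \<in> L.Gal" "g \<noteq> id"
    show "\<exists>p\<in>{1..k} <+> {1..m}. g = case_sum \<tau> \<sigma> p \<or> g = ?i (case_sum \<tau> \<sigma> p)"
    proof (cases "L.gal.ord g = 2")
      case True
      then obtain i where "i \<in> {1..k}" "g = \<tau> i"
        using bij_betw_imp_surj_on[OF bij] g(1) by blast
      then show ?thesis by (intro bexI[of _ "Inl i"]) auto
    next
      case False
      then obtain j where "j \<in> {1..m}" "g = \<sigma> j \<or> g = ?i (\<sigma> j)"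
        using all g by blast
      then show ?thesis by (intro bexI[of _ "Inr j"]) auto
    qed
  qed simp
  moreover have "(\<lambda>i. range (\<lambda>b. galois_form \<iota> b (case_sum \<tau> \<sigma> i))) = case_sum B A"
    by (auto simp: fun_eq_iff A_def B_def split: sum.split)
  ultimately have direct: "internal_direct_sum form_scale (Alt \<iota>) ({1..k} <+> {1..m}) (case_sum B A)"
    by simp

  have dimB: "real (vector_space.dim form_scale (B i)) = real n / 2" if i: "i \<in> {1..k}" for i
  proof -
    have "L.ext.dim {x. \<tau> i x = x} * 2 = n"
      using L.dim_fixed_by[OF \<tau>(1)[OF i]] \<tau>(2)[OF i] degree by simp
    then show ?thesis
      using L.dim_galois_forms_involution[OF \<tau>(1)[OF i] \<tau>'[OF i]] by (simp add: B_def)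
  qed
  have dimA: "vector_space.dim form_scale (A j) = n" if j: "j \<in> {1..m}" for j
    using L.dim_galois_forms[OF \<sigma>(1)[OF j] \<sigma>'[OF j]] degree by (simp add: A_def)
  have rankB: "form_rank \<iota> f = n" if i: "i \<in> {1..k}" and f: "f \<in> B i" "f \<noteq> 0" for i f
    using f L.radical_involution[OF \<tau>(1)[OF i] \<tau>'(1)[OF i]] L.form_rank_full degree
    by (auto simp: B_def)
  have rank_odd: "real (form_rank \<iota> f) = real n - real n / real (2 * r + 1)"
    if j: "j \<in> {1..m}" and r: "L.gal.ord (\<sigma> j) = 2 * r + 1" and f: "f \<in> A j" "f \<noteq> 0" for j r f
    using f L.form_rank_galois_form_odd[OF \<sigma>(1)[OF j] r] degree by (auto simp: A_def)
  have rank_even: "form_rank \<iota> f = n \<or> real (form_rank \<iota> f) = real n - real n / real r"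
    if j: "j \<in> {1..m}" and r: "L.gal.ord (\<sigma> j) = 2 * r" and f: "f \<in> A j" "f \<noteq> 0" for j r f
    using f L.form_rank_galois_form_even[OF \<sigma>(1)[OF j] r] degree by (auto simp: A_def)
  have full: "\<exists>f\<in>A j. f \<noteq> 0 \<and> form_rank \<iota> f = n"
    if j: "j \<in> {1..m}" and r: "L.gal.ord (\<sigma> j) = 2 * r" for j r
  proof -
    obtain b where b: "b \<noteq> 0" "form_radical (galois_form \<iota> b (\<sigma> j)) = {0}"
      using L.radical_zero_exists[OF \<sigma>(1)[OF j]] r by auto
    then show ?thesis
      using L.galois_form_nonzero[OF \<sigma>(1)[OF j] \<sigma>'[OF j] b(1)] L.form_rank_full[OF b(2)] degree
      by (auto simp: A_def)
  qed
  have partial: "\<exists>f\<in>A j. f \<noteq> 0 \<and> real (form_rank \<iota> f) = real n - real n / real r"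
    if j: "j \<in> {1..m}" and r: "L.gal.ord (\<sigma> j) = 2 * r" for j r
    \<comment> \<open>The witness is \<open>b = 1\<close>; its form is non-zero because
      \<open>\<sigma> j\<close> is not an involution.\<close>
    using L.galois_form_nonzero[OF \<sigma>(1)[OF j] \<sigma>'[OF j] one_neq_zero]
      L.form_rank_galois_form_one[OF \<sigma>(1)[OF j] r] degree
    by (auto simp: A_def)
  show ?thesis
    unfolding G_def
    by (intro conjI ballI allI impI; (elim conjE)?;
        (rule count direct | (rule dimB dimA rankB rank_odd rank_even full partial; assumption)))
qed

end
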